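(* Let $n\ge 2$, let $(k_1,\alpha_1),\dots,(k_n,\alpha_n)$ be an admissible sequence and let $\Sigma_n\in\mathbb{R}^{n\times n}$ be the asymptotic covariance matrix in the supercritical regime. Put $a_i=\frac{k_i!}{\mu_{k_i}^{(\alpha_i)}}$ for $i\in[n]$, $b=\sum_{k=1}^n\prod_{l\in[n]\setminus\{k\}}a_l^2$, $\lambda_1=0$, $\lambda_2=\sum_{i=1}^n 1/a_i^2$, and let $D=\mathrm{diag}(\lambda_1,\dots,\lambda_1,\lambda_2)\in\mathbb{R}^{n\times n}$. Let $S\in\mathbb{R}^{n\times n}$ be the matrix with column vectors $v_1,\dots,v_n$, where for $1\le i\le n-1$ the vector $v_i$ has first entry $a_1/a_{i+1}$, $(i+1)$-st entry $-1$ and all other entries $0$, and $v_n=(a_n/a_1,a_n/a_2,\dots,1)^t$. Then $\Sigma_n$ is similar to $D$ and $D=S^{-1}\Sigma_nS$, where $S^{-1}=(\tilde s_{ij})\in\mathbb{R}^{n\times n}$ has entries $$\tilde s_{ij}=\begin{cases}\dfrac{\prod_{k=1}^n a_k^2}{a_ja_n b}&\text{for } i=n,\\[2mm] -\dfrac{\sum_{k\in[n]\setminus\{i+1\}}a_{i+1}^2\prod_{l\in[n]\setminus\{k,i+1\}}a_l^2}{b}&\text{for } j=i+1,\\[2mm] \dfrac{\prod_{k=1}^n a_k^2}{a_{i+1}a_j b}&\text{else.}\end{cases}$$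
   Context: $[n]=\{1,\dots,n\}$. Fix $d\ge 1$ and let $B^d\subset\mathbb{R}^d$ be the unit ball. For $s>0$ and points $x_0,\dots,x_k\in\mathbb{R}^d$ with $k\le d$, $\Delta_s[x_0,\dots,x_k]$ is the $k$-dimensional volume of the convex hull of $x_0,\dots,x_k$ if all edge lengths $\|x_i-x_j\|$ are at most $s$, and $0$ otherwise; for $k>d$ the volume is replaced by $1$. Powers $\Delta_s[\cdot]^\alpha$ are understood to be $0$ when some edge length exceeds $s$. The list $\{x_l\}_{l=i}^j$ stands for $x_i,\dots,x_j$ (empty if $j<i$). Define $$\mu_k^{(\alpha)}=\int_{(B^d)^k}\Delta_1[0,\{x_l\}_{l=1}^k]^\alpha\,dx_1\cdots dx_k,$$ $$\mu_{k_1,k_2:m}^{(\alpha_1,\alpha_2)}=\int_{(B^d)^{k_1+k_2+1-m}}\Delta_1[0,\{x_l\}_{l=1}^{k_1}]^{\alpha_1}\,\Delta_1[0,\{x_l\}_{l=k_1-m+2}^{k_1+k_2-m+1}]^{\alpha_2}\,dx_1\cdots dx_{k_1+k_2+1-m}.$$ A sequence $(k_1,\alpha_1),\dots,(k_n,\alpha_n)$ (with $k_i$ integers, $\alpha_i$ real) is admissible if: $0\le k_1\le\dots\le k_n$; the pairs are distinct; $\alpha_i>-d+k_i-1$ and $\alpha_i+\alpha_j>-d+\min_{l\in\{i,j\}}k_l-1$ for all $i,j$; and $\alpha_i=0$ if $k_i>d$. In the supercritical regime ($t\delta_t^d\to\infty$) the asymptotic covariance matrix of the normalized vector of volume power functionals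 $(\tilde{\mathcal V}_{k_1}^{(\alpha_1)},\dots,\tilde{\mathcal V}_{k_n}^{(\alpha_n)})$ is $$\Sigma_n=\Big(\frac{\mu_{k_i,k_j:1}^{(\alpha_i,\alpha_j)}}{k_i!\,k_j!}\Big)_{i,j=1,\dots,n}.$$ *)

theory Defs
  imports "HOL-Analysis.Analysis" "Jordan_Normal_Form.Matrix"
begin

text \<open>
  Dimension-\<open>k\<close> volume of a subset \<open>A\<close> of some \<open>k\<close>-dimensional affine subspace: the Lebesgue
  measure of \<open>A\<close> read off in an isometric chart \<open>c \<mapsto> p + (\<Sum>i<k. c i *\<^sub>R e i)\<close> of such a subspace.
  The value does not depend on the chart; if \<open>A\<close> has smaller dimension it is \<open>0\<close>, and the volume
  of a point for \<open>k = 0\<close> is \<open>1\<close>.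
\<close>

definition orthonormal_frame :: "nat \<Rightarrow> (nat \<Rightarrow> 'a::euclidean_space) \<Rightarrow> bool" where
  "orthonormal_frame k e \<longleftrightarrow> (\<forall>i<k. \<forall>j<k. e i \<bullet> e j = (if i = j then 1 else 0))"

definition chart :: "nat \<Rightarrow> 'a::euclidean_space \<Rightarrow> (nat \<Rightarrow> 'a) \<Rightarrow> (nat \<Rightarrow> real) \<Rightarrow> 'a" where
  "chart k p e c = p + (\<Sum>i<k. c i *\<^sub>R e i)"

definition kvol :: "nat \<Rightarrow> 'a::euclidean_space set \<Rightarrow> real" where
  "kvol k A = (THE v. \<exists>p e. orthonormal_frame k e \<and> A \<subseteq> range (chart k p e) \<and>
     v = measure (\<Pi>\<^sub>M i\<in>{..<k}. lborel) {c \<in> {..<k} \<rightarrow>\<^sub>E UNIV. chart k p e c \<in> A})"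

text \<open>
  The argument list \<open>[x\<^sub>0, \<dots>, x\<^sub>k]\<close> has \<open>k + 1\<close> elements.
\<close>

definition edges_le :: "real \<Rightarrow> (real^'d::finite) list \<Rightarrow> bool" where
  "edges_le s xs \<longleftrightarrow> (\<forall>x\<in>set xs. \<forall>y\<in>set xs. norm (x - y) \<le> s)"

definition Delta :: "real \<Rightarrow> (real^'d::finite) list \<Rightarrow> real" where
  "Delta s xs =
     (if edges_le s xs
      then (if length xs - 1 \<le> CARD('d) then kvol (length xs - 1) (convex hull (set xs)) else 1)
      else 0)"

text \<open>
  Since \<open>0 powr 0 = 0\<close>, the exponent \<open>0\<close> is treated separately: the power is then the indicator
  of all edges being at most \<open>s\<close>. For a negative exponent, degenerate simplices
  (a null set) get the value \<open>0\<close> of \<open>0 powr \<alpha>\<close>, which does not affect the integrals below.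
\<close>

definition Delta_pow :: "real \<Rightarrow> real \<Rightarrow> (real^'d::finite) list \<Rightarrow> real" where
  "Delta_pow s \<alpha> xs =
     (if \<not> edges_le s xs then 0 else if \<alpha> = 0 then 1 else Delta s xs powr \<alpha>)"

text \<open>\<open>pts x i j\<close> is the list of the \<open>x l\<close> with \<open>i \<le> l \<le> j\<close>, empty for \<open>j < i\<close>.\<close>

definition pts :: "(nat \<Rightarrow> 'a) \<Rightarrow> nat \<Rightarrow> nat \<Rightarrow> 'a list" where
  "pts x i j = map x [i..<Suc j]"

definition mu :: "'d::finite itself \<Rightarrow> nat \<Rightarrow> real \<Rightarrow> real" where
  "mu _ k \<alpha> =
     (LINT x : (\<Pi>\<^sub>E l\<in>{1..k}. cball 0 1) | (\<Pi>\<^sub>M l\<in>{1..k}. (lborel :: (real^'d) measure)).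
        Delta_pow 1 \<alpha> (0 # pts x 1 k))"

text \<open>
  Used for \<open>1 \<le> m \<le> min k\<^sub>1 k\<^sub>2 + 1\<close>, the number of points (including the origin) shared by the two
  simplices; the truncated subtractions are then exact.
\<close>

definition mu2 :: "'d::finite itself \<Rightarrow> nat \<Rightarrow> nat \<Rightarrow> nat \<Rightarrow> real \<Rightarrow> real \<Rightarrow> real" where
  "mu2 _ k\<^sub>1 k\<^sub>2 m \<alpha>\<^sub>1 \<alpha>\<^sub>2 =
     (LINT x : (\<Pi>\<^sub>E l\<in>{1..k\<^sub>1 + k\<^sub>2 + 1 - m}. cball 0 1)
             | (\<Pi>\<^sub>M l\<in>{1..k\<^sub>1 + k\<^sub>2 + 1 - m}. (lborel :: (real^'d) measure)).
        Delta_pow 1 \<alpha>\<^sub>1 (0 # pts x 1 k\<^sub>1) *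
        Delta_pow 1 \<alpha>\<^sub>2 (0 # pts x (k\<^sub>1 + 2 - m) (k\<^sub>1 + k\<^sub>2 + 1 - m)))"

text \<open>Sequences of length \<open>n\<close> are functions on \<open>nat\<close> of which only the values on \<open>{1..n}\<close> matter.\<close>

definition admissible :: "'d::finite itself \<Rightarrow> nat \<Rightarrow> (nat \<Rightarrow> nat) \<Rightarrow> (nat \<Rightarrow> real) \<Rightarrow> bool" where
  "admissible _ n k \<alpha> \<longleftrightarrow>
     mono_on {1..n} k \<and>
     inj_on (\<lambda>i. (k i, \<alpha> i)) {1..n} \<and>
     (\<forall>i\<in>{1..n}. \<alpha> i > - real CARD('d) + real (k i) - 1) \<and>
     (\<forall>i\<in>{1..n}. \<forall>j\<in>{1..n}. \<alpha> i + \<alpha> j > - real CARD('d) + real (min (k i) (k j)) - 1) \<and>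
     (\<forall>i\<in>{1..n}. k i > CARD('d) \<longrightarrow> \<alpha> i = 0)"

text \<open>Square matrices given by entries with indices starting at \<open>1\<close>.\<close>

definition mat1 :: "nat \<Rightarrow> (nat \<Rightarrow> nat \<Rightarrow> 'a) \<Rightarrow> 'a Matrix.mat" where
  "mat1 n f = Matrix.mat n n (\<lambda>(i, j). f (Suc i) (Suc j))"

definition cov_supercritical ::
    "'d::finite itself \<Rightarrow> nat \<Rightarrow> (nat \<Rightarrow> nat) \<Rightarrow> (nat \<Rightarrow> real) \<Rightarrow> real Matrix.mat" where
  "cov_supercritical d n k \<alpha> =
     mat1 n (\<lambda>i j. mu2 d (k i) (k j) 1 (\<alpha> i) (\<alpha> j) / (fact (k i) * fact (k j)))"

end

theory Submission
  imports Defs "Jordan_Normal_Form.Determinant"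
begin

text \<open>
  With \<open>m = 1\<close> the two simplices share only the origin, so by Fubini
  \<open>\<mu>\<^bsub>k\<^sub>i,k\<^sub>j:1\<^esub> = \<mu>\<^bsub>k\<^sub>i\<^esub> \<mu>\<^bsub>k\<^sub>j\<^esub>\<close> and \<open>\<Sigma>\<^sub>n\<close> is the rank one matrix \<open>u u\<^sup>t\<close> with \<open>u\<^sub>i = 1 / a\<^sub>i\<close>; it is
  diagonalized by \<open>u\<close> together with a basis of its orthogonal complement. What remains is
  \<open>0 < \<mu>\<^sub>k < \<infinity>\<close>. The volume of a simplex is a constant times the square root of a Gram determinant,
  and adding a vertex multiplies this root by the distance of the new vertex to the span of the old
  ones. That distance is at least the geometric mean of the absolute coordinates of the new vertex
  along an orthonormal basis of the orthogonal complement. So for a negative exponent the integral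
  over the new vertex is, after a rotation, at most a product of integrals
  \<open>\<integral> \<bar>t\<bar> powr \<beta>\<close> over \<open>[-1, 1]\<close> with \<open>\<beta> > -1\<close>, uniformly in the old vertices.
\<close>

text \<open>Finiteness has to be shown as integrability: the integral of a non-integrable function
  is 0 by convention, and \<open>a i\<close>, a quotient by it, would then be 0 too. Negative
  exponents are the obstacle, since the integrand is unbounded near degenerate simplices. When k
  points are present, d - k orthogonal directions are left in which to measure the distance of a new
  vertex from their span. Keeping a single direction would require \<alpha> > -1. Splitting the
  exponent evenly over all of them, which is what the geometric mean does, requires only \<alpha> /
  (d - k) > -1, and this is precisely the lower bound on \<alpha> that admissibility gives for k + 1
  points. Because the old vertices may be linearly dependent, auxiliary orthonormal families are
  always chosen for vectors whose span has dimension at most, not exactly, the number of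
  points.\<close>

no_notation scalar_prod (infix "\<bullet>" 70)
no_notation vec_index (infixl "$" 100)

section \<open>Rank one matrices\<close>

lemma mat1_mult:
  "mat1 n f * mat1 n g = mat1 n (\<lambda>i j. \<Sum>l\<in>{1..n}. f i l * g l j)" for f g :: "nat \<Rightarrow> nat \<Rightarrow> 'a::comm_ring_1"
proof (rule eq_matI)
  fix i j assume "i < dim_row (mat1 n (\<lambda>i j. \<Sum>l\<in>{1..n}. f i l * g l j))"
    "j < dim_col (mat1 n (\<lambda>i j. \<Sum>l\<in>{1..n}. f i l * g l j))"
  then have ij: "i < n" "j < n" by (auto simp: mat1_def)
  have "(\<Sum>l\<in>{0..<n}. f (Suc i) (Suc l) * g (Suc l) (Suc j)) = (\<Sum>l\<in>{1..n}. f (Suc i) l * g l (Suc j))"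
    by (rule sum.reindex_bij_witness[of _ "\<lambda>l. l - 1" Suc]) auto
  then show "(mat1 n f * mat1 n g) $$ (i, j) = mat1 n (\<lambda>i j. \<Sum>l\<in>{1..n}. f i l * g l j) $$ (i, j)"
    using ij by (simp add: mat1_def scalar_prod_def)
qed (auto simp: mat1_def)

lemma mat1_cong:
  "(\<And>i j. i \<in> {1..n} \<Longrightarrow> j \<in> {1..n} \<Longrightarrow> f i j = g i j) \<Longrightarrow> mat1 n f = mat1 n g"
  unfolding mat1_def by (rule eq_matI) auto

lemma mat1_one: "mat1 n (\<lambda>i j. if i = j then 1 else 0) = 1\<^sub>m n"
  unfolding mat1_def by (rule eq_matI) auto

lemma mat1_carrier [simp]: "mat1 n f \<in> carrier_mat n n"
  by (simp add: mat1_def)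

text \<open>\<open>T\<close> comes from solving S c = x. The columns of \<open>S\<close> other than
  the last are orthogonal to \<open>u\<close>, so pairing with \<open>u\<close> gives c_n = u_n <u,
  x> / s. Entry i + 1 of the equation involves only the columns i and n and reads u_{i+1} c_n / u_n
  - c_i = x_{i+1}, which gives the other coefficients.\<close>

lemma rank_one_diagonalization:
  fixes u :: "nat \<Rightarrow> real"
  assumes n: "n \<ge> 2" and u: "\<And>i. i \<in> {1..n} \<Longrightarrow> u i \<noteq> 0"
  defines "s \<equiv> \<Sum>i\<in>{1..n}. (u i)\<^sup>2"
  defines "S \<equiv> mat1 n (\<lambda>i j. if j = n then u i / u n
                  else if i = 1 then u (j + 1) / u 1 else if i = j + 1 then -1 else 0)"
  defines "T \<equiv> mat1 n (\<lambda>i j. if i = n then u j * u n / s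
                  else u (i + 1) * u j / s - (if j = i + 1 then 1 else 0))"
  shows "T * S = 1\<^sub>m n"
    and "T * mat1 n (\<lambda>i j. u i * u j) * S = mat1 n (\<lambda>i j. if i = j \<and> i = n then s else 0)"
proof -
  have s: "s > 0"
    unfolding s_def using n u by (intro sum_pos) auto
  have nz: "u 1 \<noteq> 0" "u n \<noteq> 0" using n u by auto
  have col: "(\<Sum>l\<in>{1..n}. f l * (if j = n then u l / u n
                  else if l = 1 then u (j + 1) / u 1 else if l = j + 1 then -1 else 0))
     = (if j = n then (\<Sum>l\<in>{1..n}. f l * u l) / u n else f 1 * u (j + 1) / u 1 - f (j + 1))"
    (is "(\<Sum>l\<in>_. f l * ?S l) = _") if j: "j \<in> {1..n}" for f j
  proof (cases "j = n")
    case True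
    then show ?thesis by (simp add: sum_divide_distrib)
  next
    case False
    \<comment> \<open>Since 1 \<le> j < n, the positions 1 and j + 1 are distinct and both in range,
      so the column is a sum of two point masses.\<close>
    then have "(\<Sum>l\<in>{1..n}. f l * ?S l) = (\<Sum>l\<in>{1..n}. (if l = 1 then f l * (u (j + 1) / u 1) else 0)
        + (if l = j + 1 then - f l else 0))"
      using j by (intro sum.cong) auto
    also have "\<dots> = f 1 * u (j + 1) / u 1 - f (j + 1)"
      using j n False by (simp add: sum.distrib)
    finally show ?thesis using False by simp
  qed
  show "T * S = 1\<^sub>m n"
    unfolding T_def S_def mat1_mult mat1_one[symmetric]
  proof (rule mat1_cong, subst col)
    fix i j assume ij: "i \<in> {1..n}" "j \<in> {1..n}"
    have n1: "(\<Sum>l\<in>{1..n}. u l * u n / s * u l) = u n"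
    proof -
      have "(\<Sum>l\<in>{1..n}. u l * u n / s * u l) = u n / s * s"
        unfolding s_def by (subst sum_distrib_left) (auto simp: power2_eq_square intro!: sum.cong)
      then show ?thesis using s by simp
    qed
    have n2: "(\<Sum>l\<in>{1..n}. (u (i + 1) * u l / s - (if l = i + 1 then 1 else 0)) * u l) = 0"
      if "i \<noteq> n"
    proof -
      have "(\<Sum>l\<in>{1..n}. (u (i + 1) * u l / s - (if l = i + 1 then 1 else 0)) * u l)
         = (\<Sum>l\<in>{1..n}. u (i + 1) / s * (u l)\<^sup>2 - (if l = i + 1 then u l else 0))"
        by (rule sum.cong) (auto simp: power2_eq_square algebra_simps)
      also have "\<dots> = u (i + 1) / s * s - u (i + 1)"
        using that ij by (simp add: sum_subtractf s_def sum_distrib_left)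
      finally show ?thesis using s by simp
    qed
    show "(if j = n then (\<Sum>l\<in>{1..n}. (if i = n then u l * u n / s
                  else u (i + 1) * u l / s - (if l = i + 1 then 1 else 0)) * u l) / u n
           else (if i = n then u 1 * u n / s
                  else u (i + 1) * u 1 / s - (if 1 = i + 1 then 1 else 0)) * u (j + 1) / u 1
            - (if i = n then u (j + 1) * u n / s
                  else u (i + 1) * u (j + 1) / s - (if j + 1 = i + 1 then 1 else 0))) =
          (if i = j then 1 else 0)"
      using ij n1 n2 nz s by (auto simp: field_simps)
  qed auto
  \<comment> \<open>All rows of \<open>T\<close> but the last are orthogonal to \<open>u\<close>, so
    T u is \<open>u n\<close> times the last unit vector and only one row of T (u u^t)
    survives.\<close>
  have TU: "T * mat1 n (\<lambda>i j. u i * u j) = mat1 n (\<lambda>i j. if i = n then u n * u j else 0)"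
    unfolding T_def mat1_mult
  proof (rule mat1_cong)
    fix i j assume ij: "i \<in> {1..n}" "j \<in> {1..n}"
    show "(\<Sum>l\<in>{1..n}. (if i = n then u l * u n / s
             else u (i + 1) * u l / s - (if l = i + 1 then 1 else 0)) * (u l * u j)) =
          (if i = n then u n * u j else 0)"
    proof (cases "i = n")
      case True
      have "(\<Sum>l\<in>{1..n}. u l * u n / s * (u l * u j)) = u n * u j / s * s"
        unfolding s_def by (subst sum_distrib_left) (auto simp: power2_eq_square intro!: sum.cong)
      then show ?thesis using s True by simp
    next
      case False
      have "(\<Sum>l\<in>{1..n}. (u (i + 1) * u l / s - (if l = i + 1 then 1 else 0)) * (u l * u j))
         = (\<Sum>l\<in>{1..n}. u (i + 1) * u j / s * (u l)\<^sup>2 - (if l = i + 1 then u l * u j else 0))"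
        by (rule sum.cong) (auto simp: power2_eq_square algebra_simps)
      also have "\<dots> = u (i + 1) * u j / s * s - u (i + 1) * u j"
        using False ij by (simp add: sum_subtractf s_def sum_distrib_left)
      finally show ?thesis using False s by simp
    qed
  qed
  show "T * mat1 n (\<lambda>i j. u i * u j) * S = mat1 n (\<lambda>i j. if i = j \<and> i = n then s else 0)"
    unfolding TU unfolding S_def mat1_mult
  proof (rule mat1_cong, subst col)
    fix i j assume ij: "i \<in> {1..n}" "j \<in> {1..n}"
    have "(\<Sum>l\<in>{1..n}. u n * u l * u l) = u n * s"
      unfolding s_def by (simp add: sum_distrib_left power2_eq_square mult.assoc)
    then show "(if j = n then (\<Sum>l\<in>{1..n}. (if i = n then u n * u l else 0) * u l) / u n
           else (if i = n then u n * u 1 else 0) * u (j + 1) / u 1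
            - (if i = n then u n * u (j + 1) else 0)) = (if i = j \<and> i = n then s else 0)"
      using nz by auto
  qed auto
qed

text \<open>Put u_i = 1 / a_i and let P be the product of all a_l^2. Deleting the index j from this
  product leaves P u_j^2, so b = P s and P cancels from every entry of \<open>T\<close>. In the
  entries with j = i + 1 the sum is P (s - u_{i+1}^2), which produces u_{i+1}^2 / s - 1.\<close>

lemma rank_one_similar:
  fixes n :: nat and a :: "nat \<Rightarrow> real" and b l1 l2 :: real
    and v :: "nat \<Rightarrow> nat \<Rightarrow> real" and \<Sigma> D S T :: "real Matrix.mat"
  assumes n: "n \<ge> 2"
    and \<Sigma>: "\<Sigma> = mat1 n (\<lambda>i j. 1 / (a i * a j))"
    and a: "\<And>i. i \<in> {1..n} \<Longrightarrow> a i \<noteq> 0"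
    and b: "b = (\<Sum>j\<in>{1..n}. \<Prod>l\<in>{1..n} - {j}. (a l)\<^sup>2)"
    and l: "l1 = 0" "l2 = (\<Sum>i\<in>{1..n}. 1 / (a i)\<^sup>2)"
    and D: "D = mat1 n (\<lambda>i j. if i = j then (if i = n then l2 else l1) else 0)"
    and v: "\<And>i j. i \<in> {1..n-1} \<Longrightarrow> j \<in> {1..n} \<Longrightarrow>
           v i j = (if j = 1 then a 1 / a (i + 1) else if j = i + 1 then -1 else 0)"
    and vn: "\<And>j. j \<in> {1..n} \<Longrightarrow> v n j = (if j = n then 1 else a n / a j)"
    and S: "S = mat1 n (\<lambda>i j. v j i)"
    and T: "T = mat1 n (\<lambda>i j.
           if i = n then (\<Prod>l\<in>{1..n}. (a l)\<^sup>2) / (a j * a n * b)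
           else if j = i + 1 then
             - (\<Sum>m\<in>{1..n} - {i + 1}. (a (i + 1))\<^sup>2 * (\<Prod>l\<in>{1..n} - {m, i + 1}. (a l)\<^sup>2)) / b
           else (\<Prod>l\<in>{1..n}. (a l)\<^sup>2) / (a (i + 1) * a j * b))"
  shows "similar_mat \<Sigma> D \<and> inverts_mat S T \<and> inverts_mat T S \<and> D = T * \<Sigma> * S"
proof -
  define u where "u = (\<lambda>i. 1 / a i)"
  define s where "s = (\<Sum>i\<in>{1..n}. (u i)\<^sup>2)"
  define P where "P = (\<Prod>l\<in>{1..n}. (a l)\<^sup>2)"
  have u: "u i \<noteq> 0" if "i \<in> {1..n}" for i using a[OF that] by (simp add: u_def)
  have s: "s > 0"
    unfolding s_def using n u by (intro sum_pos) auto
  have P: "P \<noteq> 0" unfolding P_def using a by simp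
  have del: "(\<Prod>l\<in>{1..n} - {j}. (a l)\<^sup>2) = P * (u j)\<^sup>2" if "j \<in> {1..n}" for j
    unfolding P_def using that a[OF that]
    by (subst prod.remove[of _ j]) (auto simp: u_def power_divide)
  have del2: "(a i)\<^sup>2 * (\<Prod>l\<in>{1..n} - {m, i}. (a l)\<^sup>2) = P * (u m)\<^sup>2"
    if "i \<in> {1..n}" "m \<in> {1..n}" "m \<noteq> i" for i m
  proof -
    have *: "{1..n} - {m, i} = {1..n} - {m} - {i}" by auto
    have "(\<Prod>l\<in>{1..n} - {m}. (a l)\<^sup>2) = (a i)\<^sup>2 * (\<Prod>l\<in>{1..n} - {m, i}. (a l)\<^sup>2)"
      unfolding * using that by (intro prod.remove) auto
    then show ?thesis using del[of m] that by simp
  qed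
  have bs: "b = P * s"
    unfolding b s_def sum_distrib_left using del by (intro sum.cong) auto
  have row: "- (\<Sum>m\<in>{1..n} - {i}. (a i)\<^sup>2 * (\<Prod>l\<in>{1..n} - {m, i}. (a l)\<^sup>2)) / b
      = u i * u i / s - 1" if i: "i \<in> {1..n}" for i
  proof -
    have "(\<Sum>m\<in>{1..n} - {i}. (a i)\<^sup>2 * (\<Prod>l\<in>{1..n} - {m, i}. (a l)\<^sup>2)) = P * (\<Sum>m\<in>{1..n} - {i}. (u m)\<^sup>2)"
      unfolding sum_distrib_left using del2[OF i] by (intro sum.cong) auto
    also have "(\<Sum>m\<in>{1..n} - {i}. (u m)\<^sup>2) = s - (u i)\<^sup>2"
      unfolding s_def using i by (subst sum.remove[of _ i]) auto
    finally show ?thesis using P s by (simp add: bs field_simps power2_eq_square)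
  qed
  have S': "S = mat1 n (\<lambda>i j. if j = n then u i / u n
                  else if i = 1 then u (j + 1) / u 1 else if i = j + 1 then -1 else 0)"
    unfolding S
  proof (rule mat1_cong)
    fix i j assume ij: "i \<in> {1..n}" "j \<in> {1..n}"
    show "v j i = (if j = n then u i / u n
                  else if i = 1 then u (j + 1) / u 1 else if i = j + 1 then -1 else 0)"
    proof (cases "j = n")
      case True
      then show ?thesis using vn[of i] ij a[of n] by (auto simp: u_def)
    next
      case False
      then have "j \<in> {1..n-1}" using ij by auto
      then show ?thesis using v[of j i] ij False by (simp add: u_def)
    qed
  qed
  have T': "T = mat1 n (\<lambda>i j. if i = n then u j * u n / s
                  else u (i + 1) * u j / s - (if j = i + 1 then 1 else 0))"
    unfolding T
  proof (rule mat1_cong)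
    fix i j assume ij: "i \<in> {1..n}" "j \<in> {1..n}"
    have *: "P / (a p * a q * b) = u p * u q / s" for p q
      using P by (simp add: bs u_def)
    show "(if i = n then (\<Prod>l\<in>{1..n}. (a l)\<^sup>2) / (a j * a n * b)
           else if j = i + 1 then
             - (\<Sum>m\<in>{1..n} - {i + 1}. (a (i + 1))\<^sup>2 * (\<Prod>l\<in>{1..n} - {m, i + 1}. (a l)\<^sup>2)) / b
           else (\<Prod>l\<in>{1..n}. (a l)\<^sup>2) / (a (i + 1) * a j * b)) =
       (if i = n then u j * u n / s else u (i + 1) * u j / s - (if j = i + 1 then 1 else 0))"
      unfolding P_def[symmetric] * using row[of "i + 1"] ij by auto
  qed
  have \<Sigma>': "\<Sigma> = mat1 n (\<lambda>i j. u i * u j)"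
    unfolding \<Sigma> u_def by simp
  have D': "D = mat1 n (\<lambda>i j. if i = j \<and> i = n then s else 0)"
    unfolding D l by (rule mat1_cong) (auto simp: s_def u_def power_divide)
  have carr: "S \<in> carrier_mat n n" "T \<in> carrier_mat n n" "\<Sigma> \<in> carrier_mat n n" "D \<in> carrier_mat n n"
    unfolding S T \<Sigma> D by simp_all
  have TS: "T * S = 1\<^sub>m n" and DT: "T * \<Sigma> * S = D"
    unfolding T' S' \<Sigma>' D' s_def using rank_one_diagonalization[OF n u] by simp_all
  have ST: "S * T = 1\<^sub>m n"
    using mat_mult_left_right_inverse[OF carr(2,1) TS] .
  have "similar_mat_wit D \<Sigma> T S"
    unfolding similar_mat_wit_def Let_def using carr TS ST DT by auto
  then have "similar_mat \<Sigma> D"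
    using similar_mat_def similar_mat_sym by blast
  then show ?thesis using TS ST DT carr unfolding inverts_mat_def by auto
qed

section \<open>Gram determinants\<close>

text \<open>
  The family \<open>x\<close> is only used on \<open>K\<close>; outside \<open>K\<close> the Gram matrix is completed by the identity,
  so that all matrices are indexed by the full coordinate type.
\<close>

definition gram :: "'d::finite set \<Rightarrow> ('d \<Rightarrow> real^'d) \<Rightarrow> real" where
  "gram K x = Determinants.det (\<chi> i j. if i \<in> K \<and> j \<in> K then x i \<bullet> x j else if i = j then 1 else 0)"

text \<open>Only the values of \<open>e\<close> outside \<open>K\<close> matter.\<close>

definition completes :: "'d::finite set \<Rightarrow> (real^'d) set \<Rightarrow> ('d \<Rightarrow> real^'d) \<Rightarrow> bool" where
  "completes K X e \<longleftrightarrow> (\<forall>i\<in>-K. \<forall>j\<in>-K. e i \<bullet> e j = (if i = j then 1 else 0)) \<and>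
     (\<forall>v\<in>X. \<forall>j\<in>-K. v \<bullet> e j = 0)"

text \<open>The orthogonal complement of the span of \<open>X\<close> has dimension at least
  \<open>card (-K)\<close>, so its orthonormal basis has room for an injection from
  \<open>-K\<close>. If the vectors in \<open>X\<close> are dependent, some basis vectors are simply
  left over.\<close>

lemma completes_exists:
  fixes X :: "(real^'d::finite) set"
  assumes "dim X \<le> card K"
  obtains e where "completes K X e"
proof -
  define C where "C = {y \<in> UNIV. \<forall>x\<in>span X. real_inner_class.orthogonal x y}"
  have sub: "subspace C"
    by (auto simp: C_def subspace_def real_inner_class.orthogonal_def inner_add_right)
  have "dim C + dim (span X) = dim (UNIV :: (real^'d) set)"
    unfolding C_def by (intro dim_subspace_orthogonal_to_vectors) (auto simp: subspace_span)
  then have dimC: "dim C \<ge> card (-K)"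
    using assms card_Un_disjoint[of K "-K"] by (simp add: Compl_partition)
  have "\<exists>B\<subseteq>C. pairwise real_inner_class.orthogonal B \<and> (\<forall>x\<in>B. norm x = 1) \<and> independent B \<and> card B = dim C"
  proof (rule orthonormal_basis_subspace[OF sub])
    fix B assume B: "B \<subseteq> C" "pairwise real_inner_class.orthogonal B" "\<And>x. x \<in> B \<Longrightarrow> norm x = 1"
      "independent B" "card B = dim C"
    show ?thesis by (intro exI[of _ B] conjI ballI B)
  qed
  then obtain B where B: "B \<subseteq> C" "pairwise real_inner_class.orthogonal B" "\<forall>x\<in>B. norm x = 1"
    "independent B" "card B = dim C" by blast
  have "card (-K) \<le> card B" using B(5) dimC by simp
  moreover have "finite B" using B(4) independent_bound by blast
  ultimately obtain e where e: "e ` (-K) \<subseteq> B" "inj_on e (-K)"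
    using card_le_inj[of "-K" B] by auto
  have "e i \<bullet> e j = (if i = j then 1 else 0)" if "i \<in> -K" "j \<in> -K" for i j
  proof (cases "i = j")
    case True
    then show ?thesis using B(3) e(1) that by (auto simp: norm_eq_1)
  next
    case False
    then have "e i \<noteq> e j" using e(2) that by (auto dest: inj_onD)
    then show ?thesis using B(2) e(1) that False
      by (auto simp: pairwise_def real_inner_class.orthogonal_def image_subset_iff)
  qed
  moreover have "v \<bullet> e j = 0" if "v \<in> X" "j \<in> -K" for v j
    using e(1) B(1) that span_base[of v X]
    by (auto simp: C_def real_inner_class.orthogonal_def image_subset_iff subset_iff)
  ultimately show thesis using that[of e] unfolding completes_def by blast
qed

lemma dim_image_le_card: "finite K \<Longrightarrow> dim (x ` K) \<le> card K" for x :: "_ \<Rightarrow> 'a::euclidean_space"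
  by (metis card_image_le dim_le_card' finite_imageI le_trans)

text \<open>The square is det (A A^t), whose entries are inner products of rows. Completing the
  vectors by an orthonormal family orthogonal to them is what completes their Gram matrix by the
  identity.\<close>

lemma det_sq_eq_gram:
  fixes x :: "'d::finite \<Rightarrow> real^'d"
  assumes "completes K (x ` K) e"
  shows "(Determinants.det (\<chi> i. if i \<in> K then x i else e i))\<^sup>2 = gram K x"
proof -
  let ?A = "\<chi> i. if i \<in> K then x i else e i"
  have "(Determinants.det ?A)\<^sup>2 = Determinants.det (?A ** Finite_Cartesian_Product.transpose ?A)"
    by (simp add: det_mul power2_eq_square det_transpose)
  also have "?A ** Finite_Cartesian_Product.transpose ?A =
      (\<chi> i j. if i \<in> K \<and> j \<in> K then x i \<bullet> x j else if i = j then 1 else 0)"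
  proof -
    have "(\<Sum>k\<in>UNIV. (?A $ i) $ k * (?A $ j) $ k) =
        (if i \<in> K \<and> j \<in> K then x i \<bullet> x j else if i = j then 1 else 0)" for i j
    proof -
      have "(\<Sum>k\<in>UNIV. (?A $ i) $ k * (?A $ j) $ k) = ?A $ i \<bullet> ?A $ j"
        unfolding inner_vec_def by simp
      also have "\<dots> = (if i \<in> K \<and> j \<in> K then x i \<bullet> x j else if i = j then 1 else 0)"
        using assms by (auto simp: completes_def inner_commute)
      finally show ?thesis .
    qed
    then show ?thesis
      by (simp add: vec_eq_iff matrix_matrix_mult_def Finite_Cartesian_Product.transpose_def)
  qed
  finally show ?thesis by (simp add: gram_def)
qed

lemma gram_nonneg: "gram K x \<ge> 0"
proof -
  obtain e where "completes K (x ` K) e"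
    using completes_exists[OF dim_image_le_card[of K x]] by auto
  from det_sq_eq_gram[OF this] show ?thesis by (metis zero_le_power2)
qed

lemma gram_cong: "(\<And>i. i \<in> K \<Longrightarrow> x i = y i) \<Longrightarrow> gram K x = gram K y"
proof -
  assume *: "\<And>i. i \<in> K \<Longrightarrow> x i = y i"
  have "(\<lambda>i j. if i \<in> K \<and> j \<in> K then x i \<bullet> x j else if i = j then 1 else 0) =
      (\<lambda>i j. if i \<in> K \<and> j \<in> K then y i \<bullet> y j else if i = j then 1 else 0)"
    by (auto simp: fun_eq_iff *)
  then show ?thesis
    unfolding gram_def by (rule arg_cong[where f = "\<lambda>F. Determinants.det (\<chi> i j. F i j)"])
qed

text \<open>The vector \<open>z\<close> is the component of \<open>x i\<close> orthogonal to the span of the \<open>x j\<close> with \<open>j \<in> K\<close>.\<close>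

lemma gram_insert:
  fixes x :: "'d::finite \<Rightarrow> real^'d"
  assumes i: "i \<notin> K"
  shows "\<exists>z. gram (insert i K) x = (norm z)\<^sup>2 * gram K x \<and> norm z \<le> norm (x i) \<and>
    (\<forall>w. (\<forall>j\<in>K. x j \<bullet> w = 0) \<longrightarrow> x i \<bullet> w = z \<bullet> w)"
proof -
  obtain e where e: "completes (insert i K) (x ` insert i K) e"
    using completes_exists[OF dim_image_le_card[of "insert i K" x]] by auto
  obtain y z where yz: "y \<in> span (x ` K)" "\<And>v. v \<in> span (x ` K) \<Longrightarrow> real_inner_class.orthogonal z v"
    "x i = y + z"
    using orthogonal_subspace_decomp_exists[of "x ` K" "x i"] by metis
  define A where "A v = (\<chi> j. if j = i then v else if j \<in> K then x j else e j)" for v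
  have g: "gram (insert i K) x = (Determinants.det (A (x i)))\<^sup>2"
    unfolding det_sq_eq_gram[OF e, symmetric] A_def
    by (intro arg_cong[where f = "\<lambda>t. (Determinants.det t)\<^sup>2"]) (auto simp: vec_eq_iff)
  \<comment> \<open>Exchanging the row \<open>x i\<close> for \<open>z\<close> removes
    \<open>y\<close>, a combination of the rows indexed by \<open>K\<close>, and so preserves the
    determinant.\<close>
  have "y \<in> span {Finite_Cartesian_Product.row j (A z) |j. j \<noteq> i}"
  proof -
    have "x ` K \<subseteq> {Finite_Cartesian_Product.row j (A z) |j. j \<noteq> i}"
    proof
      fix v assume "v \<in> x ` K"
      then obtain j where j: "j \<in> K" "v = x j" by auto
      then have "v = Finite_Cartesian_Product.row j (A z)" "j \<noteq> i"
        using i by (auto simp: Finite_Cartesian_Product.row_def A_def vec_eq_iff)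
      then show "v \<in> {Finite_Cartesian_Product.row j (A z) |j. j \<noteq> i}" by blast
    qed
    then show ?thesis using yz(1) span_mono by blast
  qed
  then have "Determinants.det (\<chi> k. if k = i then Finite_Cartesian_Product.row i (A z) + y
      else Finite_Cartesian_Product.row k (A z)) = Determinants.det (A z)"
    by (intro det_row_span) (simp add: span_vec_eq)
  also have "(\<chi> k. if k = i then Finite_Cartesian_Product.row i (A z) + y
      else Finite_Cartesian_Product.row k (A z)) = A (x i)"
    by (auto simp: vec_eq_iff Finite_Cartesian_Product.row_def A_def yz(3))
  finally have dz: "Determinants.det (A (x i)) = Determinants.det (A z)" .
  have xw: "x i \<bullet> w = z \<bullet> w" if w: "\<And>j. j \<in> K \<Longrightarrow> x j \<bullet> w = 0" for w
  proof -
    have "real_inner_class.orthogonal w y"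
      using yz(1) by (rule orthogonal_to_span) (use w in \<open>auto simp: real_inner_class.orthogonal_def inner_commute[of w]\<close>)
    then show ?thesis by (simp add: real_inner_class.orthogonal_def inner_commute[of w] yz(3) inner_add_left)
  qed
  have zx: "z \<bullet> x j = 0" if "j \<in> K" for j
    using yz(2)[of "x j"] that by (auto simp: span_base real_inner_class.orthogonal_def)
  have le: "norm z \<le> norm (x i)"
  proof -
    have "(norm z)\<^sup>2 = x i \<bullet> z"
      using xw[of z] zx by (simp add: inner_commute[of "x _" z] power2_norm_eq_inner)
    also have "\<dots> \<le> norm (x i) * norm z"
      by (rule norm_cauchy_schwarz)
    finally show ?thesis
      by (cases "z = 0") (auto simp: power2_eq_square)
  qed
  have "gram (insert i K) x = (norm z)\<^sup>2 * gram K x"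
  proof (cases "z = 0")
    case True
    then have "A z $ i = 0" by (simp add: A_def)
    then show ?thesis by (simp add: g dz True det_zero_row Finite_Cartesian_Product.row_def)
  next
    case False
    \<comment> \<open>The normalized \<open>z\<close> is orthogonal to the old vectors and to the
      other \<open>e j\<close>, so it fills the place \<open>i\<close> that is missing in a
      completion of \<open>K\<close>. Pulling \<open>norm z\<close> out of row \<open>i\<close> then
      yields the factor.\<close>
    define e' where "e' = e(i := z /\<^sub>R norm z)"
    have ze: "z \<bullet> e j = 0" if "j \<notin> insert i K" for j
    proof -
      have "real_inner_class.orthogonal (e j) y"
        using yz(1)
        by (rule orthogonal_to_span) (use e that in \<open>auto simp: completes_def real_inner_class.orthogonal_def inner_commute\<close>)
      moreover have "x i \<bullet> e j = 0" using e that by (auto simp: completes_def)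
      ultimately show ?thesis by (simp add: yz(3) inner_add_left real_inner_class.orthogonal_def inner_commute[of "e j"])
    qed
    have nrm: "(z /\<^sub>R norm z) \<bullet> (z /\<^sub>R norm z) = 1"
      using False norm_eq_1[of "z /\<^sub>R norm z"] by simp
    have "completes K (x ` K) e'"
      unfolding completes_def
    proof (intro conjI ballI)
      fix j l assume jl: "j \<in> -K" "l \<in> -K"
      have 1: "e j \<bullet> e l = (if j = l then 1 else 0)" if "j \<noteq> i" "l \<noteq> i"
        using e jl that by (auto simp: completes_def)
      show "e' j \<bullet> e' l = (if j = l then 1 else 0)"
        using 1 ze[of l] ze[of j] nrm jl unfolding e'_def
        by (cases "j = i"; cases "l = i") (simp_all add: inner_commute[of "e _" z])
    next
      fix v j assume vj: "v \<in> x ` K" "j \<in> -K"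
      then obtain l where l: "l \<in> K" "v = x l" by auto
      have "x l \<bullet> e j = 0" if "j \<noteq> i"
        using e l vj that by (auto simp: completes_def)
      then show "v \<bullet> e' j = 0"
        using zx[OF l(1)] l(2) unfolding e'_def by (cases "j = i") (simp_all add: inner_commute[of "x _" z])
    qed
    then have "gram K x = (Determinants.det (\<chi> j. if j \<in> K then x j else e' j))\<^sup>2"
      by (simp add: det_sq_eq_gram)
    also have "(\<chi> j. if j \<in> K then x j else e' j) = A (z /\<^sub>R norm z)"
      using i by (auto simp: vec_eq_iff A_def e'_def)
    finally have "gram K x = (Determinants.det (A (z /\<^sub>R norm z)))\<^sup>2" .
    moreover have "Determinants.det (A z) = norm z * Determinants.det (A (z /\<^sub>R norm z))"
    proof -
      have *: "norm z *s (z /\<^sub>R norm z) = z"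
        using False by (simp add: scalar_mult_eq_scaleR)
      show ?thesis
        using det_row_mul[of i "norm z" "\<lambda>_. z /\<^sub>R norm z" "\<lambda>j. if j \<in> K then x j else e j"]
        unfolding A_def * .
    qed
    ultimately show ?thesis
      by (simp add: g dz power_mult_distrib)
  qed
  then show ?thesis using le xw by (intro exI[of _ z]) simp
qed

text \<open>Hadamard's inequality for vectors in the unit ball: each new vector contributes a factor
  at most 1. It supplies the constant majorant for positive exponents.\<close>

lemma gram_le_1:
  fixes x :: "'d::finite \<Rightarrow> real^'d"
  assumes "\<And>i. i \<in> K \<Longrightarrow> norm (x i) \<le> 1"
  shows "gram K x \<le> 1"
  using finite[of K] assms
proof (induction K rule: finite_induct)
  case empty
  have "gram {} x = Determinants.det (Finite_Cartesian_Product.mat 1 :: real^'d^'d)"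
    unfolding gram_def Finite_Cartesian_Product.mat_def by simp
  then show ?case by simp
next
  case (insert i K)
  obtain z :: "real^'d" where z: "gram (insert i K) x = (norm z)\<^sup>2 * gram K x" "norm z \<le> norm (x i)"
    using gram_insert[OF insert.hyps(2), of x] by auto
  have "norm z \<le> 1"
    using z(2) insert.prems[of i] by simp
  then have "(norm z)\<^sup>2 \<le> 1"
    by (simp add: power_le_one)
  moreover have "gram K x \<le> 1"
    using insert by simp
  ultimately show ?case
    unfolding z(1) by (intro mult_le_one gram_nonneg)
qed

section \<open>Lebesgue measure under linear and orthogonal maps\<close>

text \<open>
  The library version \<open>measure_linear_image\<close> needs a well-ordered index type, which serves only to
  evaluate the determinant of a shear as that of a triangular matrix; a row operation does it for
  any finite index type.
\<close>

lemma measure_linear_image_cart: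
  fixes f :: "real^'n::finite \<Rightarrow> real^'n"
  assumes "linear f" "S \<in> lmeasurable"
  shows "f ` S \<in> lmeasurable"
    and "measure lebesgue (f ` S) = \<bar>Determinants.det (matrix f)\<bar> * measure lebesgue S"
proof -
  define P where "P f \<longleftrightarrow> (\<forall>S\<in>lmeasurable. f ` S \<in> lmeasurable \<and>
    measure lebesgue (f ` S) = \<bar>Determinants.det (matrix f)\<bar> * measure lebesgue S)"
    for f :: "real^'n \<Rightarrow> real^'n"
  \<comment> \<open>A linear map of determinant 1 or -1 has to be tested on boxes only; this serves
    the coordinate swaps and the shears.\<close>
  have cboxI: "P f" if lin: "linear f" and det: "\<bar>Determinants.det (matrix f)\<bar> = 1"
    and box: "\<And>a b. cbox a b \<noteq> {} \<Longrightarrow> measure lebesgue (f ` cbox a b) = measure lebesgue (cbox a b)"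
    for f :: "real^'n \<Rightarrow> real^'n"
    unfolding P_def
  proof (intro ballI)
    fix S :: "(real^'n) set" assume S: "S \<in> lmeasurable"
    have "measure lebesgue (f ` cbox a b) = 1 * measure lebesgue (cbox a b)" for a b
      using box[of a b] by (cases "cbox a b = {}") auto
    from measure_linear_sufficient[OF lin S this]
    show "f ` S \<in> lmeasurable \<and> measure lebesgue (f ` S)
        = \<bar>Determinants.det (matrix f)\<bar> * measure lebesgue S"
      using det by simp
  qed
  have "P f"
    using \<open>linear f\<close>
  proof (rule induct_linear_elementary)
    fix f g :: "real^'n \<Rightarrow> real^'n"
    assume fg: "linear f" "linear g" "P f" "P g"
    then show "P (f \<circ> g)"
      unfolding P_def image_comp[symmetric] matrix_compose[OF fg(2,1)] by (simp add: det_mul abs_mult)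
  next
    fix f :: "real^'n \<Rightarrow> real^'n" and i
    assume lin: "linear f" and 0: "\<And>x. f x $ i = 0"
    have "\<not> surj f"
      using 0[of "inv_into UNIV f (axis i 1)"] by (metis axis_nth f_inv_into_f UNIV_I zero_neq_one surjD)
    then have inj: "\<not> inj f"
      using lin linear_injective_imp_surjective by blast
    then have "Determinants.det (matrix f) = 0"
      using det_nz_iff_inj[OF lin] by blast
    moreover have "negligible (f ` S)" for S
      using negligible_linear_singular_image[OF lin inj] .
    ultimately show "P f"
      unfolding P_def by (simp add: negligible_iff_measure)
  next
    fix c :: "'n \<Rightarrow> real"
    have "matrix (\<lambda>x. \<chi> i. c i * x $ i) = (\<chi> i j. if i = j then c i else 0)"
      by (auto simp: matrix_def axis_def fun_eq_iff vec_eq_iff)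
    then have "Determinants.det (matrix (\<lambda>x. \<chi> i. c i * x $ i)) = prod c UNIV"
      by (simp add: det_diagonal)
    then show "P (\<lambda>x. \<chi> i. c i * x $ i)"
      unfolding P_def by (simp add: measurable_stretch measure_stretch)
  next
    fix m n :: 'n
    let ?t = "Transposition.transpose m n" and ?h = "\<lambda>x::real^'n. \<chi> i. x $ Transposition.transpose m n i"
    have lin: "linear ?h"
      by (rule linearI) (simp_all add: Finite_Cartesian_Product.plus_vec_def scaleR_vec_def)
    have bij: "bij ?t" by simp
    have ip: "?h x \<bullet> ?h y = x \<bullet> y" for x y
      unfolding inner_vec_def using sum.reindex_bij_betw[OF bij, of "\<lambda>i. x $ i \<bullet> y $ i"] by simp
    then have "orthogonal_transformation ?h"
      using lin by (simp add: orthogonal_transformation_def)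
    then have "\<bar>Determinants.det (matrix ?h)\<bar> = 1"
      using det_orthogonal_matrix by (fastforce simp: orthogonal_transformation_matrix)
    with lin show "P ?h"
    proof (rule cboxI)
      fix a b :: "real^'n" assume ne: "cbox a b \<noteq> {}"
      have img: "?h ` cbox a b = cbox (?h a) (?h b)"
      proof (intro equalityI subsetI)
        fix y assume y: "y \<in> cbox (?h a) (?h b)"
        have "a $ i \<le> ?h y $ i \<and> ?h y $ i \<le> b $ i" for i
          using y[unfolded mem_box_cart, rule_format, of "?t i"] by simp
        then have "?h y \<in> cbox a b" by (simp add: mem_box_cart)
        moreover have "y = ?h (?h y)" by (simp add: vec_eq_iff)
        ultimately show "y \<in> ?h ` cbox a b" by blast
      qed (auto simp: mem_box_cart)
      then have "cbox (?h a) (?h b) \<noteq> {}" using ne by blast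
      then show "measure lebesgue (?h ` cbox a b) = measure lebesgue (cbox a b)"
        using ne prod.reindex_bij_betw[OF bij, of "\<lambda>i. b $ i - a $ i"]
        by (simp add: img content_cbox_cart)
    qed
  next
    fix m n :: 'n assume mn: "m \<noteq> n"
    let ?h = "\<lambda>x::real^'n. \<chi> i. if i = m then x $ m + x $ n else x $ i"
    have lin: "linear ?h"
      by (rule linearI) (auto simp: Finite_Cartesian_Product.plus_vec_def scaleR_vec_def algebra_simps fun_eq_iff)
    have "matrix ?h = (\<chi> k. if k = m then Finite_Cartesian_Product.row m (Finite_Cartesian_Product.mat 1) + 1 *s Finite_Cartesian_Product.row n (Finite_Cartesian_Product.mat 1)
        else Finite_Cartesian_Product.row k (Finite_Cartesian_Product.mat 1))"
      by (auto simp: matrix_def axis_def fun_eq_iff vec_eq_iff Finite_Cartesian_Product.plus_vec_def Finite_Cartesian_Product.row_def Finite_Cartesian_Product.mat_def)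
    then have "Determinants.det (matrix ?h) = 1"
      by (simp only: det_row_operation[OF mn] det_I)
    then have "\<bar>Determinants.det (matrix ?h)\<bar> = 1" by simp
    with lin show "P ?h"
    proof (rule cboxI)
      fix a b :: "real^'n" assume ne: "cbox a b \<noteq> {}"
      \<comment> \<open>The translation by \<open>v\<close> moves the lower bound of the n-th
        coordinate to 0, so that the shear formula for boxes applies.\<close>
      define v where "v = axis n (a $ n)"
      have tr: "cbox a b = (+) v ` cbox (a - v) (b - v)"
        using cbox_translation[of v "a - v" "b - v"] by simp
      have "?h ` cbox a b = (+) (?h v) ` (?h ` cbox (a - v) (b - v))"
        unfolding tr image_image linear_add[OF lin] ..
      then have "measure lebesgue (?h ` cbox a b) = measure lebesgue (?h ` cbox (a - v) (b - v))"
        by (simp add: measure_translation)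
      also have "\<dots> = measure lebesgue (cbox (a - v) (b - v))"
        using mn ne tr by (intro measure_shear_interval) (auto simp: v_def axis_def)
      also have "\<dots> = measure lebesgue (cbox a b)"
        unfolding tr by (rule measure_translation[symmetric])
      finally show "measure lebesgue (?h ` cbox a b) = measure lebesgue (cbox a b)" .
    qed
  qed
  then show "f ` S \<in> lmeasurable"
    and "measure lebesgue (f ` S) = \<bar>Determinants.det (matrix f)\<bar> * measure lebesgue S"
    using assms(2) unfolding P_def by blast+
qed

section \<open>Orthonormal coordinates\<close>

lemma orthogonal_transformation_orthonormal:
  fixes F :: "'d::finite \<Rightarrow> real^'d"
  assumes F: "\<And>i j. F i \<bullet> F j = (if i = j then 1 else 0)"
  shows "orthogonal_transformation (\<lambda>y. \<Sum>i\<in>UNIV. (y $ i) *\<^sub>R F i)"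
proof -
  have "linear (\<lambda>y. \<Sum>i\<in>UNIV. (y $ i) *\<^sub>R F i)"
    by (intro linearI) (simp_all add: scaleR_left_distrib sum.distrib scaleR_sum_right)
  moreover have "(\<Sum>i\<in>UNIV. (v $ i) *\<^sub>R F i) \<bullet> (\<Sum>i\<in>UNIV. (w $ i) *\<^sub>R F i) = v \<bullet> w" for v w
    unfolding inner_sum_left inner_sum_right inner_scaleR_left inner_scaleR_right F
    by (simp add: inner_vec_def if_distrib mult.commute cong: if_cong)
  ultimately show ?thesis by (simp add: orthogonal_transformation_def)
qed

lemma orthonormal_expansion:
  fixes F :: "'d::finite \<Rightarrow> real^'d"
  assumes F: "\<And>i j. F i \<bullet> F j = (if i = j then 1 else 0)"
  shows "v = (\<Sum>i\<in>UNIV. (v \<bullet> F i) *\<^sub>R F i)"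
proof -
  have "surj (\<lambda>y. \<Sum>i\<in>UNIV. (y $ i) *\<^sub>R F i)"
    using F by (intro orthogonal_transformation_surj orthogonal_transformation_orthonormal)
  then obtain y where y: "v = (\<Sum>i\<in>UNIV. (y $ i) *\<^sub>R F i)"
    by (rule surjE)
  have "v \<bullet> F j = y $ j" for j
    unfolding y inner_sum_left inner_scaleR_left F by (simp add: if_distrib cong: if_cong)
  then show ?thesis using y by simp
qed

text \<open>The preimage of a box is its image under the inverse map, which is orthogonal and so has
  determinant 1 or -1. The shift \<open>p\<close> is included because the charts in
  \<open>kvol\<close> have a base point.\<close>

lemma lborel_distr_orthonormal:
  fixes F :: "'d::finite \<Rightarrow> real^'d"
  assumes F: "\<And>i j. F i \<bullet> F j = (if i = j then 1 else 0)"
  shows "distr lborel borel (\<lambda>y. p + (\<Sum>i\<in>UNIV. (y $ i) *\<^sub>R F i)) = lborel"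
proof -
  define f where "f = (\<lambda>y. \<Sum>i\<in>UNIV. (y $ i) *\<^sub>R F i)"
  have orth: "orthogonal_transformation f"
    unfolding f_def using F by (rule orthogonal_transformation_orthonormal)
  then have lin: "linear f" by (rule orthogonal_transformation_linear)
  have orthi: "orthogonal_transformation (inv_into UNIV f)" and bij: "bij f"
    using orth orthogonal_transformation_inv orthogonal_transformation_bij by blast+
  have det1: "\<bar>Determinants.det (matrix (inv_into UNIV f))\<bar> = 1"
    using orthi det_orthogonal_matrix by (fastforce simp: orthogonal_transformation_matrix)
  have meas [measurable]: "f \<in> borel_measurable borel"
    using lin by (intro borel_measurable_continuous_onI linear_continuous_on linear_conv_bounded_linear[THEN iffD1])
  have "lborel = distr lborel borel f"
  proof (rule lborel_eqI)
    fix l u :: "real^'d" assume lu: "\<And>b. b \<in> Basis \<Longrightarrow> l \<bullet> b \<le> u \<bullet> b"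
    have vi: "f -` box l u = inv_into UNIV f ` box l u"
      using bij by (simp add: bij_vimage_eq_inv_image)
    have S: "f -` box l u \<in> sets borel"
      using measurable_sets[OF meas, of "box l u"] by simp
    have "emeasure (distr lborel borel f) (box l u) = emeasure lebesgue (inv_into UNIV f ` box l u)"
      using S by (simp add: emeasure_distr vi[symmetric])
    also have "\<dots> = ennreal (measure lebesgue (inv_into UNIV f ` box l u))"
      by (intro emeasure_eq_measure2 measure_linear_image_cart orthogonal_transformation_linear[OF orthi]) simp
    also have "\<dots> = ennreal (measure lebesgue (box l u))"
      using measure_linear_image_cart(2)[OF orthogonal_transformation_linear[OF orthi], of "box l u"] det1 by simp
    also have "\<dots> = ennreal (prod ((\<bullet>) (u - l)) Basis)"
      using lu by (simp add: measure_lborel_box_eq)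
    finally show "emeasure (distr lborel borel f) (box l u) = ennreal (prod ((\<bullet>) (u - l)) Basis)" .
  qed simp
  then have "distr lborel borel ((+) p \<circ> f) = lborel"
    using distr_distr[of "(+) p" borel borel f lborel] lborel_distr_plus[of p] by simp
  then show ?thesis by (simp add: f_def comp_def)
qed

section \<open>Integrals of products of one-dimensional powers\<close>

lemma Basis_cart_eq: "(Basis :: (real^'d::finite) set) = range (\<lambda>i. axis i 1)"
  by (auto simp: Basis_vec_def)

lemma nn_integral_lborel_prod_cart:
  fixes h :: "'d::finite \<Rightarrow> real \<Rightarrow> ennreal"
  assumes [measurable]: "\<And>i. h i \<in> borel_measurable borel"
  shows "(\<integral>\<^sup>+z. (\<Prod>i\<in>UNIV. h i (z $ i)) \<partial>lborel) = (\<Prod>i\<in>UNIV. \<integral>\<^sup>+t. h i t \<partial>lborel)"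
proof -
  have inj: "inj (\<lambda>i::'d. axis i (1::real) :: real^'d)"
    by (auto simp: inj_on_def axis_eq_axis)
  define g where "g b = h (inv_into UNIV (\<lambda>i::'d. axis i (1::real) :: real^'d) b)" for b
  have g: "g (axis i 1) = h i" for i
    unfolding g_def inv_f_f[OF inj] ..
  have "nn_integral lborel (\<lambda>z::real^'d. \<Prod>b\<in>Basis. g b (z \<bullet> b)) = (\<Prod>b\<in>(Basis::(real^'d) set). \<integral>\<^sup>+t. g b t \<partial>lborel)"
    by (rule nn_integral_lborel_prod) (auto simp: g_def)
  then show ?thesis
    unfolding Basis_cart_eq prod.reindex[OF inj] comp_def g by (simp add: cart_eq_inner_axis[symmetric])
qed

text \<open>
  The value \<open>\<infinity>\<close> at \<open>0\<close>, in place of \<open>0 powr \<beta> = 0\<close>, keeps the bound \<open>gram_insert_powr_le\<close> below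
  true everywhere and not only almost everywhere.
\<close>

definition pow_inf :: "real \<Rightarrow> real \<Rightarrow> ennreal" where
  "pow_inf \<beta> t = (if t = 0 then \<infinity> else ennreal (\<bar>t\<bar> powr \<beta>))"

lemma pow_inf_measurable [measurable]: "pow_inf \<beta> \<in> borel_measurable borel"
  unfolding pow_inf_def[abs_def] by measurable

lemma pow_inf_integral_finite:
  assumes "\<beta> > -1"
  shows "(\<integral>\<^sup>+t. indicator {-1..1} t * pow_inf \<beta> t \<partial>lborel) < \<infinity>"
proof -
  let ?g = "\<lambda>t. ennreal (indicator {0..1} t * t powr \<beta>)"
  have "(\<integral>\<^sup>+t. ?g t \<partial>lborel) = ennreal (1 powr (\<beta> + 1) / (\<beta> + 1))"
    using assms by (intro nn_integral_has_integral_lebesgue has_integral_powr_from_0) auto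
  then have fin: "(\<integral>\<^sup>+t. ?g t \<partial>lborel) < \<infinity>" by simp
  have "(\<integral>\<^sup>+t. ?g t \<partial>lborel) = (\<integral>\<^sup>+t. ?g (- t) \<partial>lborel)"
    using nn_integral_real_affine[of ?g "-1" 0] by simp
  have "(\<integral>\<^sup>+t. indicator {-1..1} t * pow_inf \<beta> t \<partial>lborel) \<le> (\<integral>\<^sup>+t. ?g t + ?g (- t) \<partial>lborel)"
  proof (rule nn_integral_mono_AE)
    \<comment> \<open>The value \<infinity> of \<open>pow_inf\<close> sits at the single point 0;
      elsewhere one of the two reflected halves dominates.\<close>
    show "AE t in lborel. indicator {-1..1} t * pow_inf \<beta> t \<le> ?g t + ?g (- t)"
      using AE_lborel_singleton[of 0]
      by eventually_elim (auto simp: pow_inf_def abs_if split: split_indicator)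
  qed
  also have "\<dots> = (\<integral>\<^sup>+t. ?g t \<partial>lborel) + (\<integral>\<^sup>+t. ?g (- t) \<partial>lborel)"
    by (rule nn_integral_add) auto
  also have "\<dots> < \<infinity>"
    using fin \<open>(\<integral>\<^sup>+t. ?g t \<partial>lborel) = (\<integral>\<^sup>+t. ?g (- t) \<partial>lborel)\<close> by simp
  finally show ?thesis .
qed

text \<open>\<open>completes (-J) {} e\<close> says that \<open>e\<close> is orthonormal on
  \<open>J\<close>. Rotating \<open>e\<close> to coordinate axes and enlarging the ball to the cube
  makes the integral a product, and the result no longer depends on \<open>e\<close>. This
  uniformity is what the induction over the vertices relies on.\<close>

lemma ball_pow_integral_bound:
  fixes J :: "'d::finite set"
  assumes "\<beta> > -1"
  shows "\<exists>C<\<infinity>. \<forall>e :: 'd \<Rightarrow> real^'d. completes (-J) {} e \<longrightarrow>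
      (\<integral>\<^sup>+y. indicator (cball 0 1) y * (\<Prod>j\<in>J. pow_inf \<beta> (y \<bullet> e j)) \<partial>lborel) \<le> C"
proof -
  define h where "h i t = indicator {-1..1} t * (if i \<in> J then pow_inf \<beta> t else 1)" for i :: 'd and t
  define C where "C = (\<Prod>i\<in>UNIV. \<integral>\<^sup>+t. h i t \<partial>lborel)"
  have [measurable]: "h i \<in> borel_measurable borel" for i
    unfolding h_def[abs_def] by measurable
  have hfin: "(\<integral>\<^sup>+t. h i t \<partial>lborel) < \<infinity>" for i
    using pow_inf_integral_finite[OF assms] by (cases "i \<in> J") (auto simp: h_def)
  have "C < \<infinity>"
    unfolding C_def using hfin by (auto simp: less_top[symmetric] ennreal_prod_eq_top)
  moreover have "(\<integral>\<^sup>+y. indicator (cball 0 1) y * (\<Prod>j\<in>J. pow_inf \<beta> (y \<bullet> e j)) \<partial>lborel) \<le> C"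
    if e: "completes (-J) {} e" for e :: "'d \<Rightarrow> real^'d"
  proof -
    obtain e' where e': "completes J (e ` J) e'"
      using completes_exists[OF dim_image_le_card[of J e]] by auto
    define F where "F i = (if i \<in> J then e i else e' i)" for i
    have F: "F i \<bullet> F j = (if i = j then 1 else 0)" for i j
      using e e' unfolding F_def completes_def by (auto simp: inner_commute[of "e' _" "e _"])
    define f where "f = (\<lambda>y. 0 + (\<Sum>i\<in>UNIV. (y $ i) *\<^sub>R F i))"
    have dist: "distr lborel borel f = lborel"
      unfolding f_def using F by (rule lborel_distr_orthonormal)
    have [measurable]: "f \<in> borel_measurable borel"
      unfolding f_def by (intro borel_measurable_continuous_onI continuous_intros)
    have fF: "f z \<bullet> F j = z $ j" for z j
      unfolding f_def inner_add_left inner_sum_left inner_scaleR_left F by (simp add: if_distrib cong: if_cong)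
    have [measurable]: "(\<lambda>y. pow_inf \<beta> (y \<bullet> e j)) \<in> borel_measurable borel" for j
      by (rule measurable_compose[OF _ pow_inf_measurable]) simp
    have meas: "(\<lambda>y. indicator (cball 0 1) y * (\<Prod>j\<in>J. pow_inf \<beta> (y \<bullet> e j))) \<in> borel_measurable borel"
      by (intro borel_measurable_times_ennreal borel_measurable_prod_ennreal borel_measurable_indicator) simp_all
    have "(\<integral>\<^sup>+y. indicator (cball 0 1) y * (\<Prod>j\<in>J. pow_inf \<beta> (y \<bullet> e j)) \<partial>lborel)
        = (\<integral>\<^sup>+y. indicator (cball 0 1) y * (\<Prod>j\<in>J. pow_inf \<beta> (y \<bullet> e j)) \<partial>distr lborel borel f)"
      by (simp add: dist)
    also have "\<dots> = (\<integral>\<^sup>+z. indicator (cball 0 1) (f z) * (\<Prod>j\<in>J. pow_inf \<beta> (f z \<bullet> e j)) \<partial>lborel)"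
      by (rule nn_integral_distr) (use meas in simp_all)
    also have "\<dots> \<le> (\<integral>\<^sup>+z. (\<Prod>i\<in>UNIV. h i (z $ i)) \<partial>lborel)"
    proof (rule nn_integral_mono)
      fix z :: "real^'d"
      have "(\<Prod>i\<in>UNIV. h i (z $ i)) = (\<Prod>i\<in>UNIV. indicator {-1..1} (z $ i)) * (\<Prod>j\<in>J. pow_inf \<beta> (z $ j))"
        unfolding h_def prod.distrib by (simp add: prod.If_cases)
      moreover have "(\<Prod>j\<in>J. pow_inf \<beta> (f z \<bullet> e j)) = (\<Prod>j\<in>J. pow_inf \<beta> (z $ j))"
        by (intro prod.cong refl) (use fF[of z] in \<open>auto simp: F_def split: if_splits\<close>, metis)
      \<comment> \<open>In any orthonormal coordinates the unit ball lies in the cube with sides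
        [-1, 1], by Cauchy-Schwarz.\<close>
      moreover have "(indicator (cball 0 1) (f z) :: ennreal) \<le> (\<Prod>i\<in>UNIV. indicator {-1..1} (z $ i))"
      proof (cases "f z \<in> cball 0 1")
        case True
        have "\<bar>z $ i\<bar> \<le> 1" for i
        proof -
          have "norm (F i) = 1" using F[of i i] by (simp add: norm_eq_1)
          then show ?thesis using Cauchy_Schwarz_ineq2[of "f z" "F i"] True by (simp add: fF)
        qed
        then have "(\<Prod>i\<in>UNIV. indicator {-1..1} (z $ i)) = (1::ennreal)"
          by (intro prod.neutral) (auto simp: abs_le_iff indicator_def minus_le_iff)
        then show ?thesis by (simp add: indicator_def)
      qed simp
      ultimately show "indicator (cball 0 1) (f z) * (\<Prod>j\<in>J. pow_inf \<beta> (f z \<bullet> e j)) \<le> (\<Prod>i\<in>UNIV. h i (z $ i))"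
        by (simp add: mult_right_mono)
    qed
    also have "\<dots> = C"
      unfolding C_def by (rule nn_integral_lborel_prod_cart) simp
    finally show ?thesis .
  qed
  ultimately show ?thesis by blast
qed

section \<open>The volume of a simplex\<close>

lemma sum_UNIV_split: "(\<Sum>i\<in>UNIV. f i) = (\<Sum>i\<in>K. f i) + (\<Sum>i\<in>-K. f i)"
  for K :: "'d::finite set" and f :: "'d \<Rightarrow> 'a::comm_monoid_add"
  using sum.union_disjoint[of K "-K" f] by (simp add: Compl_partition)

text \<open>\<open>kvol\<close> measures in a product indexed by numbers, while determinants need
  vectors indexed by the coordinate type; a numbering \<open>\<tau>\<close> of the coordinates
  translates between the two.\<close>

lemma lborel_eq_distr_PiM_cart:
  fixes \<tau> :: "'d::finite \<Rightarrow> 'b"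
  assumes \<tau>: "bij_betw \<tau> UNIV I"
  shows "distr (Pi\<^sub>M I (\<lambda>_. lborel)) borel (\<lambda>c. \<chi> i. c (\<tau> i)) = (lborel :: (real^'d) measure)"
proof (rule sym, rule lborel_eqI)
  interpret P: product_sigma_finite "\<lambda>_::'b. lborel :: real measure" ..
  have fin: "finite I" using bij_betw_finite[OF \<tau>] by simp
  have \<tau>I: "\<tau> i \<in> I" for i using \<tau> by (auto simp: bij_betw_def)
  have [measurable]: "(\<lambda>c. \<chi> i. c (\<tau> i)) \<in> borel_measurable (Pi\<^sub>M I (\<lambda>_. lborel :: real measure))"
  proof (subst borel_measurable_euclidean_space, intro ballI)
    fix b :: "real^'d" assume "b \<in> Basis"
    then obtain i where b: "b = axis i 1" by (auto simp: Basis_cart_eq)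
    have "(\<lambda>c. c (\<tau> i)) \<in> borel_measurable (Pi\<^sub>M I (\<lambda>_. lborel))"
      using measurable_component_singleton[OF \<tau>I[of i], of "\<lambda>_. lborel"] by simp
    then show "(\<lambda>c. (\<chi> i. c (\<tau> i)) \<bullet> b) \<in> borel_measurable (Pi\<^sub>M I (\<lambda>_. lborel))"
      by (simp add: b cart_eq_inner_axis[symmetric])
  qed
  fix l u :: "real^'d" assume lu: "\<And>b. b \<in> Basis \<Longrightarrow> l \<bullet> b \<le> u \<bullet> b"
  define \<sigma> where "\<sigma> = inv_into UNIV \<tau>"
  have \<sigma>: "\<sigma> (\<tau> i) = i" for i
    unfolding \<sigma>_def using \<tau> by (simp add: bij_betw_def)
  have \<tau>\<sigma>: "\<tau> (\<sigma> n) = n" if "n \<in> I" for n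
    unfolding \<sigma>_def using \<tau> that by (metis bij_betw_inv_into_right)
  have lu': "l $ i \<le> u $ i" for i
    using lu[of "axis i 1"] by (simp add: Basis_cart_eq cart_eq_inner_axis)
  have "(\<lambda>c. \<chi> i. c (\<tau> i)) -` box l u \<inter> space (Pi\<^sub>M I (\<lambda>_. lborel)) = (\<Pi>\<^sub>E n\<in>I. {l $ \<sigma> n <..< u $ \<sigma> n})"
  proof (intro equalityI subsetI)
    fix c assume "c \<in> (\<lambda>c. \<chi> i. c (\<tau> i)) -` box l u \<inter> space (Pi\<^sub>M I (\<lambda>_. lborel))"
    then have c: "\<And>i. l $ i < c (\<tau> i) \<and> c (\<tau> i) < u $ i" "c \<in> (\<Pi>\<^sub>E i\<in>I. UNIV)"
      by (auto simp: mem_box_cart space_PiM)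
    have "l $ \<sigma> n < c n \<and> c n < u $ \<sigma> n" if "n \<in> I" for n
      using c(1)[of "\<sigma> n"] \<tau>\<sigma>[OF that] by simp
    then show "c \<in> (\<Pi>\<^sub>E n\<in>I. {l $ \<sigma> n <..< u $ \<sigma> n})"
      using c(2) by (auto simp: PiE_iff)
  next
    fix c assume c: "c \<in> (\<Pi>\<^sub>E n\<in>I. {l $ \<sigma> n <..< u $ \<sigma> n})"
    have "l $ i < c (\<tau> i) \<and> c (\<tau> i) < u $ i" for i
      using PiE_mem[OF c \<tau>I[of i]] by (simp add: \<sigma>)
    then show "c \<in> (\<lambda>c. \<chi> i. c (\<tau> i)) -` box l u \<inter> space (Pi\<^sub>M I (\<lambda>_. lborel))"
      using c by (auto simp: mem_box_cart space_PiM PiE_iff)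
  qed
  then have "emeasure (distr (Pi\<^sub>M I (\<lambda>_. lborel)) borel (\<lambda>c. \<chi> i. c (\<tau> i))) (box l u)
      = emeasure (Pi\<^sub>M I (\<lambda>_. lborel)) (\<Pi>\<^sub>E n\<in>I. {l $ \<sigma> n <..< u $ \<sigma> n})"
    by (simp add: emeasure_distr)
  also have "\<dots> = (\<Prod>n\<in>I. emeasure lborel {l $ \<sigma> n <..< u $ \<sigma> n})"
    using fin by (intro P.emeasure_PiM) auto
  also have "\<dots> = (\<Prod>n\<in>I. ennreal (u $ \<sigma> n - l $ \<sigma> n))"
    by (simp add: lu')
  also have "\<dots> = (\<Prod>i\<in>UNIV. ennreal (u $ i - l $ i))"
    using prod.reindex_bij_betw[OF \<tau>, of "\<lambda>n. ennreal (u $ \<sigma> n - l $ \<sigma> n)"] by (simp add: \<sigma>)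
  also have "\<dots> = ennreal (\<Prod>i\<in>UNIV. u $ i - l $ i)"
    by (rule prod_ennreal) (simp add: lu')
  also have "(\<Prod>i\<in>UNIV. u $ i - l $ i) = prod ((\<bullet>) (u - l)) Basis"
  proof -
    have inj: "inj (\<lambda>i::'d. axis i (1::real) :: real^'d)"
      by (auto simp: inj_on_def axis_eq_axis)
    show ?thesis
      unfolding Basis_cart_eq prod.reindex[OF inj] comp_def
      by (simp add: cart_eq_inner_axis[symmetric])
  qed
  finally show "emeasure (distr (Pi\<^sub>M I (\<lambda>_. lborel)) borel (\<lambda>c. \<chi> i. c (\<tau> i))) (box l u)
     = ennreal (prod ((\<bullet>) (u - l)) Basis)" .
qed simp

text \<open>The hull is the linear image of the standard simplex spanned by 0 and the axes in
  \<open>K\<close>. Coordinates outside \<open>K\<close> do not enter the sum, so they may be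
  arbitrary nonnegative numbers; in this form every point of the prism below qualifies.\<close>

lemma convex_hull_insert_0_image:
  fixes x :: "'d::finite \<Rightarrow> 'a::real_vector"
  shows "convex hull (insert 0 (x ` K)) =
    (\<lambda>y::real^'d. \<Sum>i\<in>K. (y $ i) *\<^sub>R x i) ` {y. (\<forall>i. 0 \<le> y $ i) \<and> (\<Sum>i\<in>K. y $ i) \<le> 1}"
proof -
  define g where "g = (\<lambda>y::real^'d. \<Sum>i\<in>K. (y $ i) *\<^sub>R x i)"
  have lin: "linear g"
    unfolding g_def by (intro linearI) (simp_all add: scaleR_left_distrib sum.distrib scaleR_sum_right)
  have ga: "g (axis i 1) = x i" if "i \<in> K" for i
    unfolding g_def axis_def using that by (simp add: if_distrib[of "\<lambda>t. t *\<^sub>R _"] cong: if_cong)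
  have inj: "inj (\<lambda>i::'d. axis i (1::real) :: real^'d)"
    by (auto simp: inj_on_def axis_eq_axis)
  let ?A = "(\<lambda>i. axis i (1::real) :: real^'d) ` K"
  have gA: "g ` insert 0 ?A = insert 0 (x ` K)"
    using ga linear_0[OF lin] by (force simp: image_iff)
  have "convex hull (insert 0 ?A) = {y. (\<forall>i\<in>Basis. 0 \<le> y \<bullet> i) \<and> sum ((\<bullet>) y) ?A \<le> 1 \<and>
      (\<forall>i\<in>Basis. i \<notin> ?A \<longrightarrow> y \<bullet> i = 0)}"
    by (rule substd_simplex) (auto simp: Basis_cart_eq)
  also have "\<dots> = {y. (\<forall>i. 0 \<le> y $ i) \<and> (\<Sum>i\<in>K. y $ i) \<le> 1 \<and> (\<forall>i. i \<notin> K \<longrightarrow> y $ i = 0)}"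
    unfolding Basis_cart_eq sum.reindex[OF inj_on_subset[OF inj subset_UNIV]] comp_def
    using inj_image_mem_iff[OF inj, of _ K] by (auto simp: cart_eq_inner_axis[symmetric])
  finally have "convex hull (insert 0 (x ` K)) =
      g ` {y. (\<forall>i. 0 \<le> y $ i) \<and> (\<Sum>i\<in>K. y $ i) \<le> 1 \<and> (\<forall>i. i \<notin> K \<longrightarrow> y $ i = 0)}"
    unfolding gA[symmetric] convex_hull_linear_image[OF lin, symmetric] by (rule arg_cong)
  also have "\<dots> = g ` {y. (\<forall>i. 0 \<le> y $ i) \<and> (\<Sum>i\<in>K. y $ i) \<le> 1}"
  proof (intro equalityI subsetI)
    fix v assume "v \<in> g ` {y. (\<forall>i. 0 \<le> y $ i) \<and> (\<Sum>i\<in>K. y $ i) \<le> 1}"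
    then obtain y where y: "v = g y" "\<And>i. 0 \<le> y $ i" "(\<Sum>i\<in>K. y $ i) \<le> 1" by auto
    define z where "z = (\<chi> i. if i \<in> K then y $ i else 0)"
    have "v = g z" unfolding y(1) g_def z_def by (intro sum.cong) auto
    moreover have "(\<Sum>i\<in>K. z $ i) = (\<Sum>i\<in>K. y $ i)"
      unfolding z_def by (intro sum.cong) auto
    ultimately show "v \<in> g ` {y. (\<forall>i. 0 \<le> y $ i) \<and> (\<Sum>i\<in>K. y $ i) \<le> 1 \<and> (\<forall>i. i \<notin> K \<longrightarrow> y $ i = 0)}"
      using y by (intro image_eqI[of _ _ z]) (auto simp: z_def)
  qed auto
  finally show ?thesis unfolding g_def .
qed

text \<open>
  The standard simplex in the coordinates of \<open>K\<close> times a unit cube in the others. Thickening by the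
  cube turns \<open>card K\<close>-dimensional volumes into volumes in \<open>real^'d\<close>, where linear maps have
  determinants.
\<close>

definition std_prism :: "'d::finite set \<Rightarrow> (real^'d) set" where
  "std_prism K = {y. (\<forall>i. 0 \<le> y $ i) \<and> (\<Sum>i\<in>K. y $ i) \<le> 1 \<and> (\<forall>i\<in>-K. y $ i \<le> 1)}"

lemma compact_std_prism: "compact (std_prism K)"
proof -
  have "std_prism K \<subseteq> cbox 0 1"
  proof
    fix y assume y: "y \<in> std_prism K"
    have "y $ i \<le> 1" for i
    proof (cases "i \<in> K")
      case True
      then have "y $ i \<le> (\<Sum>i\<in>K. y $ i)"
        using y by (intro member_le_sum) (auto simp: std_prism_def)
      then show ?thesis using y by (simp add: std_prism_def)
    qed (use y in \<open>auto simp: std_prism_def\<close>)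
    then show "y \<in> cbox 0 1"
      using y by (auto simp: mem_box_cart std_prism_def)
  qed
  then have "bounded (std_prism K)"
    using bounded_cbox bounded_subset by blast
  moreover have "closed (std_prism K)"
    unfolding std_prism_def Ball_def
    by (intro closed_Collect_conj closed_Collect_all closed_Collect_imp closed_Collect_le open_Collect_const continuous_intros)
  ultimately show ?thesis by (simp add: compact_eq_bounded_closed)
qed

lemma measure_std_prism_pos: "measure lborel (std_prism K) > 0"
  for K :: "'d::finite set"
proof -
  \<comment> \<open>At most d coordinates enter the sum, so a cube of side 1/d fits into the
    prism.\<close>
  let ?u = "(\<chi> i. 1 / real CARD('d)) :: real^'d"
  have "cbox 0 ?u \<subseteq> std_prism K"
  proof
    fix y assume y: "y \<in> cbox 0 ?u"
    have "(\<Sum>i\<in>K. y $ i) \<le> of_nat (card K) * (1 / real CARD('d))"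
      using y by (intro sum_bounded_above) (auto simp: mem_box_cart)
    also have "\<dots> \<le> real CARD('d) * (1 / real CARD('d))"
      by (intro mult_right_mono) (auto intro: card_mono)
    finally have "(\<Sum>i\<in>K. y $ i) \<le> 1" by simp
    moreover have "y $ i \<le> 1" for i
      using y order_trans[of "y $ i" "1 / real CARD('d)" 1] by (auto simp: mem_box_cart)
    ultimately show "y \<in> std_prism K" using y by (auto simp: mem_box_cart std_prism_def)
  qed
  then have "measure lborel (cbox 0 ?u) \<le> measure lborel (std_prism K)"
    using compact_std_prism[of K]
    by (intro measure_mono_fmeasurable fmeasurable_compact) auto
  moreover have "measure lborel (cbox 0 ?u) > 0"
  proof -
    have "0 \<in> cbox 0 ?u" by (simp add: mem_box_cart)
    then have "cbox 0 ?u \<noteq> {}" by blast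
    then show ?thesis by (simp add: content_cbox_cart prod_pos)
  qed
  ultimately show ?thesis by simp
qed

text \<open>Completing twice: \<open>e'\<close> is an orthonormal family orthogonal to all
  \<open>x i\<close>, and \<open>f\<close> completes \<open>e'\<close> in turn. The vectors of
  \<open>f\<close> on \<open>K\<close> span the complement of \<open>e'\<close>, which contains the
  simplex even when the \<open>x i\<close> are dependent.\<close>

lemma orthonormal_frame_exists:
  fixes x :: "'d::finite \<Rightarrow> real^'d"
  obtains p and e :: "nat \<Rightarrow> real^'d"
  where "orthonormal_frame (card K) e" "convex hull (insert 0 (x ` K)) \<subseteq> range (chart (card K) p e)"
proof -
  obtain e' where e': "completes K (x ` K) e'"
    using completes_exists[OF dim_image_le_card[of K x]] by auto
  obtain f where f: "completes (-K) (e' ` (-K)) f"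
    using completes_exists[OF dim_image_le_card[of "-K" e']] by auto
  define F where "F i = (if i \<in> K then f i else e' i)" for i
  have F: "F i \<bullet> F j = (if i = j then 1 else 0)" for i j
    using e' f unfolding F_def completes_def by (auto simp: inner_commute[of "f _" "e' _"])
  obtain \<sigma> where \<sigma>: "bij_betw \<sigma> {0..<card K} K"
    using ex_bij_betw_nat_finite[of K] by auto
  define e where "e = F \<circ> \<sigma>"
  have frame: "orthonormal_frame (card K) e"
    using \<sigma> F by (auto simp: orthonormal_frame_def e_def bij_betw_def inj_on_def)
  have chart: "chart (card K) 0 e c = (\<Sum>n\<in>{..<card K}. c n *\<^sub>R e n)" for c
    by (simp add: chart_def)
  have "x i \<in> range (chart (card K) 0 e)" if i: "i \<in> K" for i
  proof -
    have "x i = (\<Sum>j\<in>UNIV. (x i \<bullet> F j) *\<^sub>R F j)"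
      using F by (rule orthonormal_expansion)
    also have "\<dots> = (\<Sum>j\<in>K. (x i \<bullet> F j) *\<^sub>R F j)"
      using e' i by (intro sum.mono_neutral_right) (auto simp: F_def completes_def)
    also have "\<dots> = (\<Sum>n\<in>{0..<card K}. (x i \<bullet> F (\<sigma> n)) *\<^sub>R F (\<sigma> n))"
      by (rule sum.reindex_bij_betw[OF \<sigma>, symmetric])
    also have "\<dots> = chart (card K) 0 e (\<lambda>n. x i \<bullet> F (\<sigma> n))"
      unfolding chart by (simp add: e_def atLeast0LessThan)
    finally show ?thesis by blast
  qed
  moreover have sub: "subspace (range (chart (card K) 0 e))"
  proof (rule subspaceI)
    show "0 \<in> range (chart (card K) 0 e)"
      by (rule image_eqI[of _ _ "\<lambda>_. 0"]) (auto simp: chart)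
  next
    fix v w assume "v \<in> range (chart (card K) 0 e)" "w \<in> range (chart (card K) 0 e)"
    then obtain c c' where "v = chart (card K) 0 e c" "w = chart (card K) 0 e c'" by auto
    then show "v + w \<in> range (chart (card K) 0 e)"
      by (intro image_eqI[of _ _ "\<lambda>n. c n + c' n"]) (auto simp: chart scaleR_left_distrib sum.distrib)
  next
    fix r v assume "v \<in> range (chart (card K) 0 e)"
    then obtain c where "v = chart (card K) 0 e c" by auto
    then show "r *\<^sub>R v \<in> range (chart (card K) 0 e)"
      by (intro image_eqI[of _ _ "\<lambda>n. r * c n"]) (auto simp: chart scaleR_sum_right)
  qed
  ultimately have "convex hull (insert 0 (x ` K)) \<subseteq> range (chart (card K) 0 e)"
    by (intro hull_minimal subspace_imp_convex) (auto simp: subspace_0)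
  then show thesis using that frame by blast
qed

text \<open>The chart is arbitrary because \<open>kvol\<close> ranges over all charts. The preimage
  under \<open>\<Psi>\<close> of the \<open>\<Phi>\<close>-image of the prism is measured twice:
  \<open>\<Psi>\<close> preserves volume and \<open>\<Phi>\<close> scales it by the root of the Gram
  determinant; on the other hand the preimage is the product of the simplex in chart coordinates
  with a unit cube.\<close>

lemma measure_chart_simplex:
  fixes x :: "'d::finite \<Rightarrow> real^'d"
  assumes frame: "orthonormal_frame (card K) e"
    and sub: "convex hull (insert 0 (x ` K)) \<subseteq> range (chart (card K) p e)"
  shows "measure (\<Pi>\<^sub>M i\<in>{..<card K}. lborel)
      {c \<in> {..<card K} \<rightarrow>\<^sub>E UNIV. chart (card K) p e c \<in> convex hull (insert 0 (x ` K))}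
    = measure lborel (std_prism K) * sqrt (gram K x)"
proof -
  interpret P: product_sigma_finite "\<lambda>_::nat. lborel :: real measure" ..
  define H where "H = convex hull (insert 0 (x ` K))"
  define k where "k = card K"
  define d where "d = CARD('d)"
  have kd: "k \<le> d" unfolding k_def d_def by (rule card_mono) auto
  define W where "W = span (e ` {..<k})"
  have chart_diff: "chart k p e c - p \<in> W" for c
    unfolding chart_def W_def by (simp, intro span_sum span_scale span_base) auto
  have "0 \<in> H" unfolding H_def by (simp add: hull_inc)
  then obtain c0 where "0 = chart k p e c0"
    using sub unfolding H_def k_def by blast
  \<comment> \<open>As the hull contains the origin, the affine subspace of the chart is the linear
    subspace \<open>W\<close> itself.\<close>
  then have pW: "p \<in> W"
    using chart_diff[of c0] span_neg[of "-p"] unfolding W_def by fastforce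
  have HW: "H \<subseteq> W"
  proof
    fix v assume "v \<in> H"
    then obtain c where "v = chart k p e c"
      using sub unfolding H_def k_def by blast
    then have "v - p \<in> W" using chart_diff by simp
    then show "v \<in> W" using pW span_add[of "v - p" _ p] unfolding W_def by simp
  qed
  have xW: "x i \<in> W" if "i \<in> K" for i
    using HW that unfolding H_def by (meson hull_inc image_eqI insertI2 subsetD)
  \<comment> \<open>The completion is taken for the frame and not for the \<open>x i\<close>: if
    these are dependent, a completion of them alone need not be orthogonal to
    \<open>W\<close>.\<close>
  have "dim (e ` {..<k}) \<le> card K"
    using dim_image_le_card[of "{..<k}" e] by (simp add: k_def)
  then obtain e' where e': "completes K (e ` {..<k}) e'"
    by (rule completes_exists)
  have We': "w \<bullet> e' j = 0" if "w \<in> W" "j \<notin> K" for w j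
  proof -
    have "real_inner_class.orthogonal (e' j) w"
      using that(1) unfolding W_def
      by (rule orthogonal_to_span)
        (use e' that in \<open>auto simp: completes_def real_inner_class.orthogonal_def inner_commute[of "e' j"]\<close>)
    then show ?thesis by (simp add: real_inner_class.orthogonal_def inner_commute)
  qed
  have e'e': "e' i \<bullet> e' j = (if i = j then 1 else 0)" if "i \<notin> K" "j \<notin> K" for i j
    using e' that by (auto simp: completes_def)
  \<comment> \<open>The numbering sends \<open>K\<close> below k and the complement to
    \<open>{k..<d}\<close>, so that the product measure can be split at k.\<close>
  obtain \<tau>1 where \<tau>1: "bij_betw \<tau>1 K {..<k}"
    using ex_bij_betw_finite_nat[of K] by (auto simp: k_def atLeast0LessThan)
  have "card (-K) = card {k..<d}"
    using card_Un_disjoint[of K "-K"] by (simp add: Compl_partition k_def d_def)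
  then obtain \<tau>2 where \<tau>2: "bij_betw \<tau>2 (-K) {k..<d}"
    using finite_same_card_bij[of "-K" "{k..<d}"] by auto
  define \<tau> where "\<tau> i = (if i \<in> K then \<tau>1 i else \<tau>2 i)" for i
  have \<tau>K: "bij_betw \<tau> K {..<k}"
    using \<tau>1 by (subst bij_betw_cong[of K \<tau> \<tau>1]) (auto simp: \<tau>_def)
  have \<tau>C: "bij_betw \<tau> (-K) {k..<d}"
    using \<tau>2 by (subst bij_betw_cong[of "-K" \<tau> \<tau>2]) (auto simp: \<tau>_def)
  have \<tau>: "bij_betw \<tau> UNIV {..<d}"
    using bij_betw_combine[OF \<tau>K \<tau>C] kd by (simp add: Compl_partition ivl_disj_un ivl_disj_int)
  define F where "F i = (if i \<in> K then e (\<tau> i) else e' i)" for i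
  have \<tau>lt: "\<tau> i < k" if "i \<in> K" for i using \<tau>K that by (auto simp: bij_betw_def)
  have eW: "e n \<in> W" if "n < k" for n
    unfolding W_def using that by (auto intro: span_base)
  have F: "F i \<bullet> F j = (if i = j then 1 else 0)" for i j
  proof -
    have "e (\<tau> i) \<bullet> e (\<tau> j) = (if i = j then 1 else 0)" if "i \<in> K" "j \<in> K"
      using frame \<tau>lt that \<tau>K unfolding orthonormal_frame_def k_def[symmetric]
      by (auto simp: bij_betw_def inj_on_def)
    then show ?thesis
      using We' eW \<tau>lt e'e' unfolding F_def by (auto simp: inner_commute[of "e' _" "e _"])
  qed
  define R where "R i = (if i \<in> K then x i else e' i)" for i
  define \<Phi> where "\<Phi> = (\<lambda>y::real^'d. \<Sum>i\<in>UNIV. (y $ i) *\<^sub>R R i)"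
  define \<Psi> where "\<Psi> = (\<lambda>y::real^'d. p + (\<Sum>i\<in>UNIV. (y $ i) *\<^sub>R F i))"
  have lin: "linear \<Phi>"
    unfolding \<Phi>_def by (intro linearI) (simp_all add: scaleR_left_distrib sum.distrib scaleR_sum_right)
  have "\<bar>Determinants.det (matrix \<Phi>)\<bar> = sqrt (gram K x)"
  proof -
    have "\<Phi> (axis j 1) = R j" for j
      unfolding \<Phi>_def axis_def by (simp add: if_distrib[of "\<lambda>t. t *\<^sub>R _"] cong: if_cong)
    then have "matrix \<Phi> = Finite_Cartesian_Product.transpose (\<chi> i. R i)"
      by (simp add: matrix_def Finite_Cartesian_Product.transpose_def)
    moreover have "(\<chi> i. R i) = (\<chi> i. if i \<in> K then x i else e' i)"
      by (simp add: R_def)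
    moreover have "completes K (x ` K) e'"
      using e' We' xW by (auto simp: completes_def)
    ultimately have "(Determinants.det (matrix \<Phi>))\<^sup>2 = gram K x"
      using det_sq_eq_gram[of K x e'] by (simp add: det_transpose)
    then show ?thesis by (metis real_sqrt_abs)
  qed
  then have m\<Phi>: "measure lebesgue (\<Phi> ` std_prism K)
      = sqrt (gram K x) * measure lebesgue (std_prism K)"
    by (simp add: measure_linear_image_cart(2)[OF lin lmeasurable_compact[OF compact_std_prism]])
  have comp\<Phi>: "compact (\<Phi> ` std_prism K)"
    using lin compact_std_prism by (intro compact_continuous_image linear_continuous_on) (simp add: linear_conv_bounded_linear)
  have split\<Phi>: "\<Phi> y = (\<Sum>i\<in>K. (y $ i) *\<^sub>R x i) + (\<Sum>i\<in>-K. (y $ i) *\<^sub>R e' i)" for y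
    unfolding \<Phi>_def sum_UNIV_split[of _ K] by (simp add: R_def)
  have split\<Psi>: "\<Psi> y = (p + (\<Sum>i\<in>K. (y $ i) *\<^sub>R e (\<tau> i))) + (\<Sum>i\<in>-K. (y $ i) *\<^sub>R e' i)" for y
    unfolding \<Psi>_def sum_UNIV_split[of _ K] by (simp add: F_def add.assoc)
  have comp_e': "(w + (\<Sum>i\<in>-K. (y $ i) *\<^sub>R e' i)) \<bullet> e' j = y $ j" if "w \<in> W" "j \<notin> K" for w y j
  proof -
    have "(\<Sum>i\<in>-K. (y $ i) *\<^sub>R e' i) \<bullet> e' j = (\<Sum>i\<in>-K. if i = j then y $ i else 0)"
      unfolding inner_sum_left using that(2) by (intro sum.cong) (auto simp: e'e')
    then show ?thesis using We'[OF that] that(2) by (simp add: inner_add_left)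
  qed
  have W1: "(\<Sum>i\<in>K. (y $ i) *\<^sub>R x i) \<in> W" for y :: "real^'d"
    using xW unfolding W_def by (intro span_sum span_scale)
  have W2: "p + (\<Sum>i\<in>K. (y $ i) *\<^sub>R e (\<tau> i)) \<in> W" for y :: "real^'d"
    using pW eW \<tau>lt unfolding W_def by (intro span_add span_sum span_scale) auto
  \<comment> \<open>Inner products with \<open>e' j\<close> read off the coordinates outside
    \<open>K\<close> on both sides; what is left lies in \<open>W\<close> and is a point of the
    simplex or not.\<close>
  have key: "\<Psi> y \<in> \<Phi> ` std_prism K \<longleftrightarrow>
      p + (\<Sum>i\<in>K. (y $ i) *\<^sub>R e (\<tau> i)) \<in> H \<and> (\<forall>j\<in>-K. 0 \<le> y $ j \<and> y $ j \<le> 1)" for y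
  proof
    assume "\<Psi> y \<in> \<Phi> ` std_prism K"
    then obtain q where q: "\<Psi> y = \<Phi> q" "q \<in> std_prism K" by auto
    have yq: "y $ j = q $ j" if "j \<notin> K" for j
      using comp_e'[OF W1 that, of q q] comp_e'[OF W2 that, of y y] q(1)
      unfolding split\<Phi> split\<Psi> by simp
    then have "(\<Sum>i\<in>-K. (y $ i) *\<^sub>R e' i) = (\<Sum>i\<in>-K. (q $ i) *\<^sub>R e' i)"
      by (intro sum.cong) auto
    then have "p + (\<Sum>i\<in>K. (y $ i) *\<^sub>R e (\<tau> i)) = (\<Sum>i\<in>K. (q $ i) *\<^sub>R x i)"
      using q(1) unfolding split\<Phi> split\<Psi> by simp
    also have "\<dots> \<in> H"
      unfolding H_def convex_hull_insert_0_image using q(2) by (intro imageI) (simp add: std_prism_def)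
    finally show "p + (\<Sum>i\<in>K. (y $ i) *\<^sub>R e (\<tau> i)) \<in> H \<and> (\<forall>j\<in>-K. 0 \<le> y $ j \<and> y $ j \<le> 1)"
      using yq q(2) by (simp add: std_prism_def)
  next
    assume y: "p + (\<Sum>i\<in>K. (y $ i) *\<^sub>R e (\<tau> i)) \<in> H \<and> (\<forall>j\<in>-K. 0 \<le> y $ j \<and> y $ j \<le> 1)"
    then obtain q where q: "p + (\<Sum>i\<in>K. (y $ i) *\<^sub>R e (\<tau> i)) = (\<Sum>i\<in>K. (q $ i) *\<^sub>R x i)"
      "\<And>i. 0 \<le> q $ i" "(\<Sum>i\<in>K. q $ i) \<le> 1"
      unfolding H_def convex_hull_insert_0_image by auto
    define z where "z = (\<chi> i. if i \<in> K then q $ i else y $ i)"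
    have "(\<Sum>i\<in>K. z $ i) = (\<Sum>i\<in>K. q $ i)" "(\<Sum>i\<in>K. (z $ i) *\<^sub>R x i) = (\<Sum>i\<in>K. (q $ i) *\<^sub>R x i)"
      "(\<Sum>i\<in>-K. (z $ i) *\<^sub>R e' i) = (\<Sum>i\<in>-K. (y $ i) *\<^sub>R e' i)"
      unfolding z_def by (auto intro!: sum.cong)
    then have "\<Psi> y = \<Phi> z" "z \<in> std_prism K"
      using q y unfolding split\<Phi> split\<Psi> by (auto simp: std_prism_def z_def)
    then show "\<Psi> y \<in> \<Phi> ` std_prism K" by blast
  qed
  let ?A = "{c \<in> {..<k} \<rightarrow>\<^sub>E UNIV. chart k p e c \<in> H}"
  let ?Z = "\<Pi>\<^sub>E n\<in>{k..<d}. {0..1::real}"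
  let ?\<iota> = "\<lambda>c::nat \<Rightarrow> real. \<chi> i. c (\<tau> i)"
  let ?X = "\<Psi> -` (\<Phi> ` std_prism K)"
  have [measurable]: "\<Psi> \<in> borel_measurable borel"
    unfolding \<Psi>_def by (intro borel_measurable_continuous_onI continuous_intros)
  have X: "?X \<in> sets borel"
    using measurable_sets[of \<Psi> borel borel] comp\<Phi> by (simp add: borel_compact)
  have "emeasure lborel ?X = emeasure lborel (\<Phi> ` std_prism K)"
  proof -
    have dist: "distr lborel borel \<Psi> = lborel"
      unfolding \<Psi>_def using F by (rule lborel_distr_orthonormal)
    have "emeasure (distr lborel borel \<Psi>) (\<Phi> ` std_prism K) = emeasure lborel ?X"
      using comp\<Phi> by (simp add: emeasure_distr borel_compact)
    then show ?thesis unfolding dist by (rule sym)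
  qed
  then have mX: "measure lborel ?X = measure lborel (std_prism K) * sqrt (gram K x)"
  proof -
    assume eq: "emeasure lborel ?X = emeasure lborel (\<Phi> ` std_prism K)"
    have leb: "measure lebesgue S = measure lborel S"
      if "compact S" for S :: "(real^'d) set"
      using that by (intro measure_completion) (simp add: borel_compact)
    have "measure lborel ?X = measure lborel (\<Phi> ` std_prism K)"
      unfolding Sigma_Algebra.measure_def eq ..
    then show ?thesis
      using m\<Phi> by (simp add: leb comp\<Phi> compact_std_prism)
  qed
  have Hclosed: "H \<in> sets borel"
    unfolding H_def by (intro borel_compact finite_imp_compact_convex_hull) simp
  have chart_meas: "chart k p e \<in> borel_measurable (\<Pi>\<^sub>M i\<in>{..<k}. lborel)"
    unfolding chart_def[abs_def] by measurable
  have A: "?A \<in> sets (\<Pi>\<^sub>M i\<in>{..<k}. lborel)"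
  proof -
    have "?A = chart k p e -` H \<inter> space (\<Pi>\<^sub>M i\<in>{..<k}. lborel)"
      by (auto simp: space_PiM)
    then show ?thesis using measurable_sets[OF chart_meas Hclosed] by simp
  qed
  have \<iota>_meas: "?\<iota> \<in> borel_measurable (\<Pi>\<^sub>M i\<in>{..<d}. lborel)"
  proof (subst borel_measurable_euclidean_space, intro ballI)
    fix b :: "real^'d" assume "b \<in> Basis"
    then obtain i where b: "b = axis i 1" by (auto simp: Basis_cart_eq)
    have "\<tau> i \<in> {..<d}" using \<tau> by (auto simp: bij_betw_def)
    from measurable_component_singleton[OF this, of "\<lambda>_. lborel :: real measure"]
    show "(\<lambda>c. ?\<iota> c \<bullet> b) \<in> borel_measurable (\<Pi>\<^sub>M i\<in>{..<d}. lborel)"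
      by (simp add: b cart_eq_inner_axis[symmetric])
  qed
  have un: "{..<k} \<union> {k..<d} = {..<d}" using kd by auto
  \<comment> \<open>The first k coordinates are chart coordinates and the remaining ones run through
    the unit cube, whose measure is 1.\<close>
  have merge: "merge {..<k} {k..<d} -` (?\<iota> -` ?X \<inter> space (\<Pi>\<^sub>M i\<in>{..<d}. lborel))
      \<inter> space ((\<Pi>\<^sub>M i\<in>{..<k}. lborel) \<Otimes>\<^sub>M (\<Pi>\<^sub>M i\<in>{k..<d}. lborel)) = ?A \<times> ?Z"
  proof -
    have eq: "merge {..<k} {k..<d} (c, z) \<in> ?\<iota> -` ?X \<longleftrightarrow> chart k p e c \<in> H \<and> z \<in> ?Z"
      if z: "z \<in> {k..<d} \<rightarrow>\<^sub>E UNIV" for c z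
    proof -
      let ?m = "merge {..<k} {k..<d} (c, z)"
      have "(\<Sum>i\<in>K. (?\<iota> ?m $ i) *\<^sub>R e (\<tau> i)) = (\<Sum>i\<in>K. c (\<tau> i) *\<^sub>R e (\<tau> i))"
        using \<tau>lt by (intro sum.cong) (auto simp: merge_def)
      also have "\<dots> = (\<Sum>n<k. c n *\<^sub>R e n)"
        by (rule sum.reindex_bij_betw[OF \<tau>K])
      finally have 1: "p + (\<Sum>i\<in>K. (?\<iota> ?m $ i) *\<^sub>R e (\<tau> i)) = chart k p e c"
        by (simp add: chart_def)
      have "(\<forall>j\<in>-K. 0 \<le> ?\<iota> ?m $ j \<and> ?\<iota> ?m $ j \<le> 1) \<longleftrightarrow> (\<forall>n\<in>\<tau> ` (-K). 0 \<le> ?m n \<and> ?m n \<le> 1)"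
        by simp
      also have "\<tau> ` (-K) = {k..<d}" using \<tau>C by (simp add: bij_betw_def)
      also have "(\<forall>n\<in>{k..<d}. 0 \<le> ?m n \<and> ?m n \<le> 1) \<longleftrightarrow> z \<in> ?Z"
        using z by (auto simp: merge_def PiE_iff)
      finally show ?thesis
        using key[of "?\<iota> ?m"] 1 by simp
    qed
    have sp: "merge {..<k} {k..<d} (c, z) \<in> space (\<Pi>\<^sub>M i\<in>{..<d}. lborel)" for c z :: "nat \<Rightarrow> real"
      using kd by (auto simp: space_PiM merge_def PiE_iff extensional_def)
    show ?thesis
    proof (rule Set.set_eqI)
      fix w :: "(nat \<Rightarrow> real) \<times> (nat \<Rightarrow> real)"
      obtain c z where w: "w = (c, z)" by (cases w)
      have "w \<in> space ((\<Pi>\<^sub>M i\<in>{..<k}. lborel) \<Otimes>\<^sub>M (\<Pi>\<^sub>M i\<in>{k..<d}. lborel)) \<longleftrightarrow>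
          c \<in> {..<k} \<rightarrow>\<^sub>E UNIV \<and> z \<in> {k..<d} \<rightarrow>\<^sub>E UNIV"
        by (simp add: w space_pair_measure space_PiM)
      moreover have "z \<in> {k..<d} \<rightarrow>\<^sub>E UNIV" if "z \<in> ?Z"
        using that by (simp add: PiE_iff)
      ultimately show "w \<in> merge {..<k} {k..<d} -` (?\<iota> -` ?X \<inter> space (\<Pi>\<^sub>M i\<in>{..<d}. lborel))
          \<inter> space ((\<Pi>\<^sub>M i\<in>{..<k}. lborel) \<Otimes>\<^sub>M (\<Pi>\<^sub>M i\<in>{k..<d}. lborel)) \<longleftrightarrow> w \<in> ?A \<times> ?Z"
        using eq[of z c] sp[of c z] unfolding w vimage_eq Int_iff mem_Times_iff mem_Collect_eq fst_conv snd_conv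
        by blast
    qed
  qed
  have "emeasure lborel ?X = emeasure (\<Pi>\<^sub>M i\<in>{..<d}. lborel) (?\<iota> -` ?X \<inter> space (\<Pi>\<^sub>M i\<in>{..<d}. lborel))"
    using X \<iota>_meas by (subst lborel_eq_distr_PiM_cart[OF \<tau>, symmetric]) (simp add: emeasure_distr)
  also have "\<dots> = emeasure ((\<Pi>\<^sub>M i\<in>{..<k}. lborel) \<Otimes>\<^sub>M (\<Pi>\<^sub>M i\<in>{k..<d}. lborel)) (?A \<times> ?Z)"
  proof -
    have dm: "distr ((\<Pi>\<^sub>M i\<in>{..<k}. lborel) \<Otimes>\<^sub>M (\<Pi>\<^sub>M i\<in>{k..<d}. lborel))
        (\<Pi>\<^sub>M i\<in>{..<d}. lborel) (merge {..<k} {k..<d}) = (\<Pi>\<^sub>M i\<in>{..<d}. lborel :: real measure)"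
      using P.distr_merge[of "{..<k}" "{k..<d}"] un by (simp add: ivl_disj_int)
    have "merge {..<k} {k..<d} \<in> measurable
        ((\<Pi>\<^sub>M i\<in>{..<k}. lborel) \<Otimes>\<^sub>M (\<Pi>\<^sub>M i\<in>{k..<d}. lborel)) (\<Pi>\<^sub>M i\<in>{..<d}. lborel :: real measure)"
      using measurable_merge[of "{..<k}" "{k..<d}" "\<lambda>_. lborel :: real measure"] un by simp
    from emeasure_distr[OF this measurable_sets[OF \<iota>_meas X]]
    show ?thesis unfolding dm merge .
  qed
  also have "\<dots> = emeasure (\<Pi>\<^sub>M i\<in>{..<k}. lborel) ?A * emeasure (\<Pi>\<^sub>M i\<in>{k..<d}. lborel) ?Z"
    by (intro sigma_finite_measure.emeasure_pair_measure_Times P.sigma_finite A) (auto intro!: sets_PiM_I_finite)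
  also have "emeasure (\<Pi>\<^sub>M i\<in>{k..<d}. lborel) ?Z = 1"
    by (subst P.emeasure_PiM) auto
  finally have "measure lborel ?X = measure (\<Pi>\<^sub>M i\<in>{..<k}. lborel) ?A"
    by (simp add: Sigma_Algebra.measure_def)
  then show ?thesis using mX by (simp add: k_def H_def)
qed

text \<open>The definite description is justified by one existing chart together with a value that
  is the same in every chart; degenerate simplices are included, with Gram determinant 0.\<close>

lemma kvol_simplex:
  fixes x :: "'d::finite \<Rightarrow> real^'d"
  shows "kvol (card K) (convex hull (insert 0 (x ` K))) = measure lborel (std_prism K) * sqrt (gram K x)"
proof -
  obtain p e where pe: "orthonormal_frame (card K) e"
    "convex hull (insert 0 (x ` K)) \<subseteq> range (chart (card K) p e)"
    by (rule orthonormal_frame_exists)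
  show ?thesis
    unfolding kvol_def
    by (rule the_equality, intro exI[of _ p] exI[of _ e] conjI, rule pe(1), rule pe(2),
      rule measure_chart_simplex[OF pe, symmetric], elim exE conjE, simp only: measure_chart_simplex)
qed

section \<open>Integrability and positivity\<close>

lemma prod_mono_ennreal:
  fixes f g :: "'i \<Rightarrow> ennreal"
  shows "(\<And>i. i \<in> A \<Longrightarrow> f i \<le> g i) \<Longrightarrow> prod f A \<le> prod g A"
  by (induction A rule: infinite_finite_induct) (auto intro: mult_mono)

text \<open>
  By \<open>gram_insert\<close> each \<open>\<bar>z i \<bullet> e j\<bar>\<close> is a lower bound for the distance of \<open>z i\<close> to the span; the lemma
  is the product of the bounds over all \<open>j \<notin> K\<close>, each raised to the power \<open>\<beta> / 2\<close>.
\<close>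

lemma gram_insert_powr_le:
  fixes z e :: "'d::finite \<Rightarrow> real^'d"
  assumes i: "i \<notin> K" and e: "completes K (z ` K) e" and \<beta>: "\<beta> < 0"
  shows "ennreal (gram (insert i K) z powr (real (card (-K)) * \<beta> / 2))
    \<le> ennreal (gram K z powr (real (card (-K)) * \<beta> / 2)) * (\<Prod>j\<in>-K. pow_inf \<beta> (z i \<bullet> e j))"
proof (cases "gram (insert i K) z = 0")
  \<comment> \<open>If the larger determinant vanishes, the left side is 0 because
    \<open>0 powr _ = 0\<close>.\<close>
  case False
  define g where "g = gram K z"
  define g' where "g' = gram (insert i K) z"
  obtain v where v: "g' = (norm v)\<^sup>2 * g" "\<forall>w. (\<forall>j\<in>K. z j \<bullet> w = 0) \<longrightarrow> z i \<bullet> w = v \<bullet> w"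
    unfolding g_def g'_def using gram_insert[OF i, of z] by auto
  have g': "g' > 0"
    using False gram_nonneg[of "insert i K" z] by (simp add: g'_def)
  then have g: "g > 0"
    using v(1) gram_nonneg[of K z] unfolding g_def by (metis less_eq_real_def mult_zero_right)
  have factor: "ennreal (g' powr (\<beta> / 2)) \<le> ennreal (g powr (\<beta> / 2)) * pow_inf \<beta> (z i \<bullet> e j)"
    if j: "j \<in> -K" for j
  proof (cases "z i \<bullet> e j = 0")
    \<comment> \<open>Here \<open>pow_inf\<close> is \<infinity> and its cofactor is positive, so
      the right side is \<infinity>.\<close>
    case True
    have "ennreal (g powr (\<beta> / 2)) \<noteq> 0"
      using g by (simp add: ennreal_eq_0_iff)
    then show ?thesis by (simp add: pow_inf_def True ennreal_mult_top)
  next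
    case False
    have nej: "norm (e j) = 1"
      using e j by (simp add: completes_def norm_eq_1)
    have "z i \<bullet> e j = v \<bullet> e j"
      using e j v(2) by (auto simp: completes_def)
    then have "\<bar>z i \<bullet> e j\<bar> \<le> norm v"
      using Cauchy_Schwarz_ineq2[of v "e j"] nej by simp
    then have "(\<bar>z i \<bullet> e j\<bar>)\<^sup>2 \<le> (norm v)\<^sup>2"
      by (rule power_mono) simp
    then have "g * \<bar>z i \<bullet> e j\<bar>\<^sup>2 \<le> g'"
      unfolding v(1) using g by (simp add: mult.commute mult_left_mono)
    then have "g' powr (\<beta> / 2) \<le> (g * \<bar>z i \<bullet> e j\<bar>\<^sup>2) powr (\<beta> / 2)"
      using \<beta> g False by (intro powr_mono2') auto
    also have "\<dots> = g powr (\<beta> / 2) * \<bar>z i \<bullet> e j\<bar> powr \<beta>"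
    proof -
      have "(\<bar>z i \<bullet> e j\<bar> powr 2) powr (\<beta> / 2) = \<bar>z i \<bullet> e j\<bar> powr \<beta>"
        by (simp only: powr_powr) simp
      moreover have "\<bar>z i \<bullet> e j\<bar> powr 2 = \<bar>z i \<bullet> e j\<bar>\<^sup>2"
        using False by (subst powr_numeral) auto
      ultimately show ?thesis using g by (simp add: powr_mult)
    qed
    finally show ?thesis
      using False by (simp add: pow_inf_def flip: ennreal_mult')
  qed
  have pow: "(\<Prod>j\<in>-K. ennreal (t powr (\<beta> / 2))) = ennreal (t powr (real (card (-K)) * \<beta> / 2))"
    if "t > 0" for t
  proof -
    have "t powr (real (card (-K)) * \<beta> / 2) = (t powr (\<beta> / 2)) ^ card (-K)"
      using that by (simp add: powr_powr mult.commute flip: powr_realpow)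
    then show ?thesis by (simp add: ennreal_power)
  qed
  have "(\<Prod>j\<in>-K. ennreal (g' powr (\<beta> / 2))) \<le> (\<Prod>j\<in>-K. ennreal (g powr (\<beta> / 2)) * pow_inf \<beta> (z i \<bullet> e j))"
    using factor by (rule prod_mono_ennreal)
  then show ?thesis
    unfolding prod.distrib pow[OF g] pow[OF g'] by (simp add: g_def g'_def)
qed simp

lemma gram_measurable:
  fixes \<rho> :: "'d::finite \<Rightarrow> 'i"
  assumes "\<rho> ` K \<subseteq> I"
  shows "(\<lambda>x. gram K (x \<circ> \<rho>)) \<in> borel_measurable (\<Pi>\<^sub>M l\<in>I. (lborel :: (real^'d) measure))"
proof -
  have [measurable]: "(\<lambda>x. x (\<rho> i)) \<in> borel_measurable (\<Pi>\<^sub>M l\<in>I. (lborel :: (real^'d) measure))"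
    if "i \<in> K" for i
    using measurable_component_singleton[of "\<rho> i" I "\<lambda>_. lborel :: (real^'d) measure"] assms that by auto
  have "(\<lambda>x. if i \<in> K \<and> j \<in> K then (x \<circ> \<rho>) i \<bullet> (x \<circ> \<rho>) j else if i = j then 1 else 0)
      \<in> borel_measurable (\<Pi>\<^sub>M l\<in>I. (lborel :: (real^'d) measure))" for i j
    by (cases "i \<in> K \<and> j \<in> K") auto
  then show ?thesis
    unfolding gram_def Determinants.det_def
    by (intro borel_measurable_sum borel_measurable_times borel_measurable_prod) simp_all
qed

text \<open>Points are numbered from 1 but \<open>gram\<close> takes a set of coordinates; via
  \<open>\<rho>\<close> the points 1 to k correspond to the coordinate set
  \<open>{i. \<rho> i \<le> k}\<close>.\<close>

lemma index_set_image:
  fixes \<rho> :: "'d::finite \<Rightarrow> nat"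
  assumes \<rho>: "bij_betw \<rho> UNIV {1..CARD('d)}" and k: "k \<le> CARD('d)"
  shows "\<rho> ` {i. \<rho> i \<le> k} = {1..k}" and "card {i. \<rho> i \<le> k} = k"
proof -
  show im: "\<rho> ` {i. \<rho> i \<le> k} = {1..k}"
  proof (intro equalityI subsetI)
    fix l assume l: "l \<in> {1..k}"
    then have "l \<in> \<rho> ` UNIV" using \<rho> k by (auto simp: bij_betw_def)
    then show "l \<in> \<rho> ` {i. \<rho> i \<le> k}" using l by auto
  qed (use \<rho> in \<open>auto simp: bij_betw_def\<close>)
  have "inj_on \<rho> {i. \<rho> i \<le> k}"
    using \<rho> by (auto simp: bij_betw_def inj_on_def)
  from card_image[OF this] show "card {i. \<rho> i \<le> k} = k" by (simp add: im)
qed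

text \<open>The last vertex is integrated first. Its integral is at most a constant times the
  integrand for the remaining vertices, whatever their position, so the constant factors out and the
  induction closes.\<close>

lemma gram_powr_integral_finite:
  fixes \<rho> :: "'d::finite \<Rightarrow> nat"
  assumes \<rho>: "bij_betw \<rho> UNIV {1..CARD('d)}" and "\<alpha> < 0"
  shows "k \<le> CARD('d) \<Longrightarrow> \<alpha> > - real CARD('d) + real k - 1 \<Longrightarrow>
    (\<integral>\<^sup>+x. indicator (\<Pi>\<^sub>E l\<in>{1..k}. cball 0 1) x * ennreal (gram {i. \<rho> i \<le> k} (x \<circ> \<rho>) powr (\<alpha> / 2))
      \<partial>(\<Pi>\<^sub>M l\<in>{1..k}. (lborel :: (real^'d) measure))) < \<infinity>"
proof (induction k)
  case 0
  interpret P: product_sigma_finite "\<lambda>_::nat. lborel :: (real^'d) measure" ..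
  show ?case by (simp add: P.nn_integral_empty ennreal_mult_less_top indicator_def)
next
  case (Suc k)
  interpret P: product_sigma_finite "\<lambda>_::nat. lborel :: (real^'d) measure" ..
  define K where "K = {i. \<rho> i \<le> k}"
  define M where "M = (\<lambda>_::nat. lborel :: (real^'d) measure)"
  have \<rho>inj: "\<rho> i = \<rho> j \<longleftrightarrow> i = j" for i j
    using \<rho> by (auto simp: bij_betw_def inj_on_def)
  have \<rho>1: "1 \<le> \<rho> i" for i using \<rho> by (auto simp: bij_betw_def)
  obtain i0 where i0: "\<rho> i0 = Suc k"
    using \<rho> Suc.prems(1) unfolding bij_betw_def
    by (metis Suc_le_eq atLeastAtMost_iff imageE le_add1 plus_1_eq_Suc zero_less_Suc)
  have K_Suc: "{i. \<rho> i \<le> Suc k} = insert i0 K"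
    using i0 \<rho>inj by (auto simp: K_def le_Suc_eq) (metis i0 \<rho>inj)
  have i0K: "i0 \<notin> K" by (simp add: K_def i0)
  have cardK: "card K = k"
    unfolding K_def using \<rho> Suc.prems(1) by (intro index_set_image) auto
  define m where "m = card (-K)"
  have m: "m + k = CARD('d)"
    using card_Un_disjoint[of K "-K"] by (simp add: Compl_partition m_def cardK)
  have m0: "m > 0" using m Suc.prems(1) by simp
  \<comment> \<open>With m = d - k, the assumption for \<open>Suc k\<close> vertices reads \<alpha>
    > -m, that is, \<beta> > -1.\<close>
  define \<beta> where "\<beta> = \<alpha> / real m"
  have \<beta>: "\<beta> > -1" "\<beta> < 0" "real m * \<beta> = \<alpha>"
    using m0 Suc.prems(2) \<open>\<alpha> < 0\<close> m unfolding \<beta>_def by (auto simp: field_simps)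
  obtain C where C: "C < \<infinity>" "\<And>e :: 'd \<Rightarrow> real^'d. completes K {} e \<Longrightarrow>
      (\<integral>\<^sup>+y. indicator (cball 0 1) y * (\<Prod>j\<in>-K. pow_inf \<beta> (y \<bullet> e j)) \<partial>lborel) \<le> C"
    using ball_pow_integral_bound[OF \<beta>(1), of "-K"] unfolding double_compl by blast
  let ?f = "\<lambda>k x. indicator (\<Pi>\<^sub>E l\<in>{1..k}. cball 0 1) x * ennreal (gram {i. \<rho> i \<le> k} (x \<circ> \<rho>) powr (\<alpha> / 2))"
  have meas: "?f k \<in> borel_measurable (Pi\<^sub>M {1..k} M)" if "k \<le> CARD('d)" for k
  proof -
    have "(\<Pi>\<^sub>E l\<in>{1..k}. cball 0 1) \<in> sets (Pi\<^sub>M {1..k} M)"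
      by (intro sets_PiM_I_finite) (auto simp: M_def)
    moreover have "(\<lambda>x. gram {i. \<rho> i \<le> k} (x \<circ> \<rho>)) \<in> borel_measurable (Pi\<^sub>M {1..k} M)"
      unfolding M_def by (rule gram_measurable) (use \<rho>1 in auto)
    ultimately show ?thesis by measurable
  qed
  have bound: "(\<integral>\<^sup>+y. ?f (Suc k) (x(Suc k := y)) \<partial>M (Suc k)) \<le> ?f k x * C"
    if x: "x \<in> space (Pi\<^sub>M {1..k} M)" for x
  proof -
    obtain e where e: "completes K ((x \<circ> \<rho>) ` K) e"
      using completes_exists[OF dim_image_le_card[of K "x \<circ> \<rho>"]] by auto
    \<comment> \<open>The completion \<open>e\<close> is fixed by the old vertices, so the bound
      holds for all \<open>y\<close> at once and may be integrated over \<open>y\<close>.\<close>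
    have le: "?f (Suc k) (x(Suc k := y)) \<le> ?f k x * (indicator (cball 0 1) y * (\<Prod>j\<in>-K. pow_inf \<beta> (y \<bullet> e j)))" for y
    proof (cases "x(Suc k := y) \<in> (\<Pi>\<^sub>E l\<in>{1..Suc k}. cball 0 1)")
      case True
      define z where "z = x(Suc k := y) \<circ> \<rho>"
      have "x l \<in> cball 0 1" if "l \<in> {1..k}" for l
        using PiE_mem[OF True, of l] that by (auto split: if_splits)
      then have xP: "x \<in> (\<Pi>\<^sub>E l\<in>{1..k}. cball 0 1)"
        using x by (auto simp: space_PiM PiE_iff)
      have y: "y \<in> cball 0 1"
        using PiE_mem[OF True, of "Suc k"] by simp
      have zK: "z i = (x \<circ> \<rho>) i" if "i \<in> K" for i
        using that by (simp add: z_def K_def)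
      then have "z ` K = (x \<circ> \<rho>) ` K" by (rule image_cong[OF refl])
      then have "completes K (z ` K) e" using e by simp
      from gram_insert_powr_le[OF i0K this \<beta>(2)]
      have "ennreal (gram (insert i0 K) z powr (\<alpha> / 2))
          \<le> ennreal (gram K z powr (\<alpha> / 2)) * (\<Prod>j\<in>-K. pow_inf \<beta> (z i0 \<bullet> e j))"
        unfolding m_def[symmetric] \<beta>(3) .
      moreover have "gram K z = gram K (x \<circ> \<rho>)"
        using zK by (rule gram_cong)
      moreover have "z i0 = y" by (simp add: z_def i0)
      ultimately show ?thesis
        using True xP y unfolding K_Suc K_def[symmetric] z_def[symmetric] by simp
    qed simp
    have "(\<integral>\<^sup>+y. ?f (Suc k) (x(Suc k := y)) \<partial>M (Suc k))
        \<le> (\<integral>\<^sup>+y. ?f k x * (indicator (cball 0 1) y * (\<Prod>j\<in>-K. pow_inf \<beta> (y \<bullet> e j))) \<partial>lborel)"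
      unfolding M_def using le by (intro nn_integral_mono) 
    also have "\<dots> = ?f k x * (\<integral>\<^sup>+y. indicator (cball 0 1) y * (\<Prod>j\<in>-K. pow_inf \<beta> (y \<bullet> e j)) \<partial>lborel)"
    proof (rule nn_integral_cmult)
      have [measurable]: "(\<lambda>y. pow_inf \<beta> (y \<bullet> e j)) \<in> borel_measurable borel" for j
        by (rule measurable_compose[OF _ pow_inf_measurable]) simp
      show "(\<lambda>y. indicator (cball 0 1) y * (\<Prod>j\<in>-K. pow_inf \<beta> (y \<bullet> e j))) \<in> borel_measurable lborel"
        by (intro borel_measurable_times_ennreal borel_measurable_prod_ennreal borel_measurable_indicator) simp_all
    qed
    also have "\<dots> \<le> ?f k x * C"
      using e by (intro mult_left_mono C(2)) (auto simp: completes_def)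
    finally show ?thesis .
  qed
  have ins: "{1..Suc k} = insert (Suc k) {1..k}" by auto
  have "integral\<^sup>N (Pi\<^sub>M {1..Suc k} M) (?f (Suc k))
      = (\<integral>\<^sup>+x. \<integral>\<^sup>+y. ?f (Suc k) (x(Suc k := y)) \<partial>M (Suc k) \<partial>Pi\<^sub>M {1..k} M)"
    using P.product_nn_integral_insert[of "{1..k}" "Suc k" "?f (Suc k)"] meas[OF Suc.prems(1)]
    unfolding ins M_def by simp
  also have "\<dots> \<le> (\<integral>\<^sup>+x. ?f k x * C \<partial>Pi\<^sub>M {1..k} M)"
    using bound by (rule nn_integral_mono)
  also have "\<dots> = (\<integral>\<^sup>+x. ?f k x \<partial>Pi\<^sub>M {1..k} M) * C"
    using meas[of k] Suc.prems(1) by (intro nn_integral_multc) simp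
  also have "\<dots> < \<infinity>"
  proof -
    have "(\<integral>\<^sup>+x. ?f k x \<partial>Pi\<^sub>M {1..k} M) < \<infinity>"
      unfolding M_def using Suc.prems by (intro Suc.IH) auto
    then show ?thesis using C(1) by (simp add: ennreal_mult_less_top)
  qed
  finally show ?case unfolding M_def .
qed

section \<open>Powers of simplex volumes as integrands\<close>

lemma set_pts [simp]: "set (pts x i j) = x ` {i..j}"
  by (auto simp: pts_def)

lemma length_pts [simp]: "length (pts x i j) = Suc j - i"
  by (auto simp: pts_def Suc_diff_le)

lemma edges_le_origin:
  "edges_le 1 (0 # pts x 1 k) \<longleftrightarrow> (\<forall>i\<in>{1..k}. norm (x i) \<le> 1) \<and> (\<forall>i\<in>{1..k}. \<forall>j\<in>{1..k}. norm (x i - x j) \<le> 1)"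
  by (auto simp: edges_le_def)

lemma Delta_pow_nonneg: "Delta_pow s \<alpha> xs \<ge> 0"
  by (simp add: Delta_pow_def)

text \<open>The exponent 0 is excluded: there \<open>Delta_pow\<close> is 1 also on degenerate
  simplices, whereas \<open>0 powr 0 = 0\<close>.\<close>

lemma Delta_pow_simplex:
  fixes \<rho> :: "'d::finite \<Rightarrow> nat" and x :: "nat \<Rightarrow> real^'d"
  assumes \<rho>: "bij_betw \<rho> UNIV {1..CARD('d)}" and k: "k \<le> CARD('d)" and "\<alpha> \<noteq> 0"
  defines "K \<equiv> {i. \<rho> i \<le> k}"
  shows "Delta_pow 1 \<alpha> (0 # pts x 1 k) = (if edges_le 1 (0 # pts x 1 k)
    then measure lborel (std_prism K) powr \<alpha> * gram K (x \<circ> \<rho>) powr (\<alpha> / 2) else 0)"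
proof -
  have "set (0 # pts x 1 k) = insert 0 ((x \<circ> \<rho>) ` K)"
    unfolding image_comp[symmetric] K_def index_set_image[OF \<rho> k] by simp
  then have "kvol k (convex hull set (0 # pts x 1 k))
      = measure lborel (std_prism K) * sqrt (gram K (x \<circ> \<rho>))"
    using kvol_simplex[of K "x \<circ> \<rho>"] index_set_image[OF \<rho> k] by (simp add: K_def)
  moreover have "sqrt (gram K (x \<circ> \<rho>)) powr \<alpha> = gram K (x \<circ> \<rho>) powr (\<alpha> / 2)"
    by (simp add: powr_half_sqrt[OF gram_nonneg, symmetric] powr_powr)
  ultimately show ?thesis
    using k \<open>\<alpha> \<noteq> 0\<close> measure_std_prism_pos[of K] gram_nonneg[of K "x \<circ> \<rho>"]
    by (simp add: Delta_pow_def Delta_def powr_mult)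
qed

lemma index_bij_exists: "\<exists>\<rho>. bij_betw \<rho> (UNIV :: 'd::finite set) {1..CARD('d)}"
  by (rule finite_same_card_bij) auto

text \<open>The edge condition only shrinks the integrand, and the product of balls has finite
  measure. For \<alpha> = 0, which includes all k > d, the majorant is 1; for \<alpha> < 0 it is a
  multiple of the power of the Gram determinant; for \<alpha> > 0 it is constant.\<close>

lemma Delta_pow_integrable:
  assumes \<alpha>: "\<alpha> > - real CARD('d) + real k - 1" and k\<alpha>: "k > CARD('d) \<Longrightarrow> \<alpha> = 0"
  shows "integrable (\<Pi>\<^sub>M l\<in>{1..k}. (lborel :: (real^'d::finite) measure))
    (\<lambda>x. indicator (\<Pi>\<^sub>E l\<in>{1..k}. cball 0 1) x *\<^sub>R Delta_pow 1 \<alpha> (0 # pts x 1 k))"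
proof -
  define M where "M = (\<lambda>_::nat. lborel :: (real^'d) measure)"
  interpret P: product_sigma_finite M unfolding M_def ..
  obtain \<rho> where \<rho>: "bij_betw \<rho> (UNIV :: 'd set) {1..CARD('d)}"
    using index_bij_exists by blast
  define K where "K = {i. \<rho> i \<le> k}"
  let ?B = "\<Pi>\<^sub>E l\<in>{1..k}. cball 0 1 :: (real^'d) set"
  let ?c = "measure lborel (std_prism K)"
  have B [measurable]: "?B \<in> sets (Pi\<^sub>M {1..k} M)"
    by (intro sets_PiM_I_finite) (auto simp: M_def)
  have Bfin: "emeasure (Pi\<^sub>M {1..k} M) ?B < \<infinity>"
  proof -
    have "emeasure (Pi\<^sub>M {1..k} M) ?B = (\<Prod>l\<in>{1..k}. emeasure lborel (cball (0::real^'d) 1))"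
      by (subst P.emeasure_PiM) (auto simp: M_def)
    also have "\<dots> < \<infinity>"
      using emeasure_lborel_cball_finite[of "0::real^'d" 1]
      by (auto simp: less_top[symmetric] power_eq_top_ennreal)
    finally show ?thesis .
  qed
  have comp [measurable]: "(\<lambda>x. x i) \<in> borel_measurable (Pi\<^sub>M {1..k} M)" if "i \<in> {1..k}" for i
    using measurable_component_singleton[OF that, of M] by (simp add: M_def)
  have [measurable]: "Measurable.pred (Pi\<^sub>M {1..k} M) (\<lambda>x. edges_le 1 (0 # pts x 1 k))"
    unfolding edges_le_origin
  proof (intro pred_intros_logic pred_intros_finite)
    fix i j assume ij: "i \<in> {1..k}" "j \<in> {1..k}"
    show "Measurable.pred (Pi\<^sub>M {1..k} M) (\<lambda>x. norm (x i) \<le> 1)"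
      using comp[OF ij(1)] by measurable
    show "Measurable.pred (Pi\<^sub>M {1..k} M) (\<lambda>x. norm (x i - x j) \<le> 1)"
      using comp[OF ij(1)] comp[OF ij(2)] by measurable
  qed auto
  have gram_meas [measurable]: "(\<lambda>x. gram K (x \<circ> \<rho>)) \<in> borel_measurable (Pi\<^sub>M {1..k} M)"
    unfolding M_def by (rule gram_measurable) (use \<rho> in \<open>auto simp: K_def bij_betw_def\<close>)
  have D_meas [measurable]: "(\<lambda>x. Delta_pow 1 \<alpha> (0 # pts x 1 k)) \<in> borel_measurable (Pi\<^sub>M {1..k} M)"
  proof (cases "\<alpha> = 0")
    case True
    have eq: "(\<lambda>x. Delta_pow 1 \<alpha> (0 # pts x 1 k)) = (\<lambda>x :: nat \<Rightarrow> real^'d. if edges_le 1 (0 # pts x 1 k) then 1 else 0)"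
      by (simp add: Delta_pow_def True fun_eq_iff)
    show ?thesis unfolding eq by measurable
  next
    case False
    then have kd: "k \<le> CARD('d)" using k\<alpha> by (metis not_le)
    show ?thesis
      unfolding Delta_pow_simplex[OF \<rho> kd False] K_def[symmetric] by measurable
  qed
  have dom: "integrable (Pi\<^sub>M {1..k} M) (\<lambda>x. indicator ?B x *\<^sub>R Delta_pow 1 \<alpha> (0 # pts x 1 k))"
    if f: "\<And>x. x \<in> ?B \<Longrightarrow> ennreal (Delta_pow 1 \<alpha> (0 # pts x 1 k)) \<le> f x"
      and fin: "(\<integral>\<^sup>+x. indicator ?B x * f x \<partial>Pi\<^sub>M {1..k} M) < \<infinity>" for f
  proof (rule integrableI_bounded)
    have "(\<integral>\<^sup>+x. ennreal (norm (indicator ?B x *\<^sub>R Delta_pow 1 \<alpha> (0 # pts x 1 k))) \<partial>Pi\<^sub>M {1..k} M)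
      \<le> (\<integral>\<^sup>+x. indicator ?B x * f x \<partial>Pi\<^sub>M {1..k} M)"
      using f by (intro nn_integral_mono) (simp add: Delta_pow_nonneg indicator_def)
    then show "(\<integral>\<^sup>+x. ennreal (norm (indicator ?B x *\<^sub>R Delta_pow 1 \<alpha> (0 # pts x 1 k))) \<partial>Pi\<^sub>M {1..k} M) < \<infinity>"
      using fin by (rule le_less_trans)
  qed measurable
  have const: "(\<integral>\<^sup>+x. indicator ?B x * ennreal r \<partial>Pi\<^sub>M {1..k} M) < \<infinity>" for r
    unfolding nn_integral_multc[OF borel_measurable_indicator[OF B]] nn_integral_indicator[OF B]
    using Bfin by (simp only: ennreal_mult_less_top infinity_ennreal_def ennreal_less_top simp_thms)
  have "integrable (Pi\<^sub>M {1..k} M) (\<lambda>x. indicator ?B x *\<^sub>R Delta_pow 1 \<alpha> (0 # pts x 1 k))"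
  proof (cases "\<alpha> = 0")
    case True
    show ?thesis
      by (rule dom[OF _ const[of 1]]) (simp add: Delta_pow_def True)
  next
    case False
    then have kd: "k \<le> CARD('d)" using k\<alpha> by (metis not_le)
    have "Delta_pow 1 \<alpha> (0 # pts x 1 k) \<le> ?c powr \<alpha> * gram K (x \<circ> \<rho>) powr (\<alpha> / 2)" for x :: "nat \<Rightarrow> real^'d"
      unfolding Delta_pow_simplex[OF \<rho> kd False] K_def[symmetric] by simp
    then have le: "ennreal (Delta_pow 1 \<alpha> (0 # pts x 1 k)) \<le> ennreal (?c powr \<alpha>) * ennreal (gram K (x \<circ> \<rho>) powr (\<alpha> / 2))"
      for x :: "nat \<Rightarrow> real^'d"
      by (simp add: ennreal_leI flip: ennreal_mult')
    show ?thesis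
    proof (cases "\<alpha> < 0")
      case True
      show ?thesis
      proof (rule dom[OF le])
        have "(\<integral>\<^sup>+x. indicator ?B x * (ennreal (?c powr \<alpha>) * ennreal (gram K (x \<circ> \<rho>) powr (\<alpha> / 2))) \<partial>Pi\<^sub>M {1..k} M)
          = ennreal (?c powr \<alpha>) * (\<integral>\<^sup>+x. indicator ?B x * ennreal (gram K (x \<circ> \<rho>) powr (\<alpha> / 2)) \<partial>Pi\<^sub>M {1..k} M)"
          by (subst nn_integral_cmult[symmetric]) (measurable, simp add: mult.left_commute)
        also have "\<dots> < \<infinity>"
          using gram_powr_integral_finite[OF \<rho> True kd \<alpha>] unfolding M_def K_def by (simp add: ennreal_mult_less_top)
        finally show "(\<integral>\<^sup>+x. indicator ?B x * (ennreal (?c powr \<alpha>) * ennreal (gram K (x \<circ> \<rho>) powr (\<alpha> / 2))) \<partial>Pi\<^sub>M {1..k} M) < \<infinity>" .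
      qed
    next
      case pos: False
      show ?thesis
      proof (rule dom[OF _ const])
        fix x assume x: "x \<in> ?B"
        have "norm ((x \<circ> \<rho>) i) \<le> 1" if "i \<in> K" for i
        proof -
          have "\<rho> i \<in> {1..k}" using index_set_image(1)[OF \<rho> kd] that unfolding K_def by blast
          from PiE_mem[OF x this] show ?thesis by simp
        qed
        \<comment> \<open>For \<alpha> > 0 the power is monotone, so Hadamard's inequality bounds it
          by 1.\<close>
        then have "gram K (x \<circ> \<rho>) powr (\<alpha> / 2) \<le> 1 powr (\<alpha> / 2)"
          using pos by (intro powr_mono2 gram_nonneg gram_le_1) auto
        then have "ennreal (?c powr \<alpha>) * ennreal (gram K (x \<circ> \<rho>) powr (\<alpha> / 2)) \<le> ennreal (?c powr \<alpha>) * ennreal 1"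
          by (intro mult_left_mono ennreal_leI) auto
        then have "ennreal (?c powr \<alpha>) * ennreal (gram K (x \<circ> \<rho>) powr (\<alpha> / 2)) \<le> ennreal (?c powr \<alpha>)"
          by simp
        with le[of x] show "ennreal (Delta_pow 1 \<alpha> (0 # pts x 1 k)) \<le> ennreal (?c powr \<alpha>)"
          by (rule order_trans)
      qed
    qed
  qed
  then show ?thesis unfolding M_def .
qed

text \<open>Continuity of the determinant in sequential form: points converging to \<open>p\<close>
  with Gram determinant \<le> 0 would force \<open>gram K p \<le> 0\<close>.\<close>

lemma gram_pos_nhd:
  fixes p :: "'d::finite \<Rightarrow> real^'d"
  assumes "gram K p > 0"
  shows "\<exists>\<epsilon>>0. \<forall>z. (\<forall>i\<in>K. dist (z i) (p i) < \<epsilon>) \<longrightarrow> gram K z > 0"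
proof (rule ccontr)
  assume neg: "\<not> ?thesis"
  have "\<exists>z. (\<forall>i\<in>K. dist (z i) (p i) < inverse (real (Suc n))) \<and> gram K z \<le> 0" for n
    using neg by (metis inverse_positive_iff_positive not_less of_nat_0_less_iff zero_less_Suc)
  then obtain Z where Z: "\<And>n i. i \<in> K \<Longrightarrow> dist (Z n i) (p i) < inverse (real (Suc n))" "\<And>n. gram K (Z n) \<le> 0"
    by metis
  have lim: "(\<lambda>n. Z n i) \<longlonglongrightarrow> p i" if "i \<in> K" for i
  proof (rule metric_tendsto_imp_tendsto[OF LIMSEQ_inverse_real_of_nat])
    show "\<forall>\<^sub>F n in sequentially. dist (Z n i) (p i) \<le> dist (inverse (real (Suc n))) 0"
      using Z(1)[OF that] by (intro always_eventually allI) (simp add: less_imp_le)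
  qed
  have "(\<lambda>n. if i \<in> K \<and> j \<in> K then Z n i \<bullet> Z n j else if i = j then 1 else 0)
      \<longlonglongrightarrow> (if i \<in> K \<and> j \<in> K then p i \<bullet> p j else if i = j then 1 else 0)" for i j
    using lim by (auto intro!: tendsto_intros)
  then have "(\<lambda>n. gram K (Z n)) \<longlonglongrightarrow> gram K p"
    unfolding gram_def Determinants.det_def by (intro tendsto_intros) simp
  then have "gram K p \<le> 0"
    using Z(2) by (intro LIMSEQ_le_const2) auto
  then show False using assms by simp
qed

text \<open>A nonnegative integrable function with integral 0 vanishes almost everywhere, but this
  one is strictly positive on a product of small balls of positive measure. Without integrability
  the vanishing of the integral would say nothing.\<close>

lemma mu_pos:
  assumes \<alpha>: "\<alpha> > - real CARD('d) + real k - 1" and k\<alpha>: "k > CARD('d) \<Longrightarrow> \<alpha> = 0"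
  shows "mu TYPE('d::finite) k \<alpha> > 0"
proof -
  define M where "M = (\<lambda>_::nat. lborel :: (real^'d) measure)"
  interpret P: product_sigma_finite M unfolding M_def ..
  obtain \<rho> where \<rho>: "bij_betw \<rho> (UNIV :: 'd set) {1..CARD('d)}"
    using index_bij_exists by blast
  define K where "K = {i. \<rho> i \<le> k}"
  define G where "G = (\<lambda>x :: nat \<Rightarrow> real^'d. indicator (\<Pi>\<^sub>E l\<in>{1..k}. cball 0 1) x *\<^sub>R Delta_pow 1 \<alpha> (0 # pts x 1 k))"
  have int: "integrable (Pi\<^sub>M {1..k} M) G"
    unfolding M_def G_def using \<alpha> k\<alpha> by (rule Delta_pow_integrable)
  have nonneg: "G x \<ge> 0" for x
    unfolding G_def by (simp add: Delta_pow_nonneg)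
  have mu: "mu TYPE('d) k \<alpha> = integral\<^sup>L (Pi\<^sub>M {1..k} M) G"
    unfolding mu_def set_lebesgue_integral_def M_def G_def ..
  \<comment> \<open>Orthogonal vectors make the Gram matrix diagonal. Length 1/4 and radius \<le>
    1/4 keep the perturbed points within distance 1/2 of the origin, so no edge exceeds 1.\<close>
  define p where "p i = (1/4) *\<^sub>R axis i (1::real)" for i :: 'd
  have pn: "norm (p i) = 1/4" for i by (simp add: p_def)
  have "gram K p = (\<Prod>i\<in>UNIV. if i \<in> K then 1/16 else 1)"
    unfolding gram_def by (subst det_diagonal) (auto simp: p_def inner_axis_axis intro!: prod.cong)
  also have "\<dots> > 0" by (rule prod_pos) auto
  finally obtain \<epsilon>0 where \<epsilon>0: "\<epsilon>0 > 0" "\<And>z. (\<forall>i\<in>K. dist (z i) (p i) < \<epsilon>0) \<Longrightarrow> gram K z > 0"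
    using gram_pos_nhd by blast
  define \<epsilon> where "\<epsilon> = min \<epsilon>0 (1/4)"
  have \<epsilon>: "\<epsilon> > 0" "\<epsilon> \<le> 1/4" "\<epsilon> \<le> \<epsilon>0" using \<epsilon>0 by (auto simp: \<epsilon>_def)
  \<comment> \<open>For l > d the inverse is some unspecified coordinate. The norm of
    \<open>q l\<close> is still 1/4, which suffices because \<alpha> = 0 when k > d.\<close>
  define q where "q l = p (inv_into UNIV \<rho> l)" for l
  have q\<rho>: "q (\<rho> i) = p i" for i
    unfolding q_def using \<rho> by (simp add: bij_betw_def)
  have qn: "norm (q l) = 1/4" for l by (simp add: q_def pn)
  define B where "B = (\<Pi>\<^sub>E l\<in>{1..k}. ball (q l) \<epsilon>)"
  have GB: "G x > 0" if x: "x \<in> B" for x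
  proof -
    have xq: "dist (x l) (q l) < \<epsilon>" if "l \<in> {1..k}" for l
      using PiE_mem[OF x[unfolded B_def] that] by (simp add: dist_commute)
    have xn: "norm (x l) \<le> 1/2" if "l \<in> {1..k}" for l
      using xq[OF that] \<epsilon>(2) qn[of l] norm_triangle_sub[of "x l" "q l"] by (simp add: dist_norm)
    have xd: "norm (x l - x l') \<le> 1" if "l \<in> {1..k}" "l' \<in> {1..k}" for l l'
      using norm_triangle_ineq4[of "x l" "x l'"] xn[OF that(1)] xn[OF that(2)] by simp
    have edges: "edges_le 1 (0 # pts x 1 k)"
      unfolding edges_le_origin using xd xn by (auto intro: order_trans[of _ "1/2"])
    have xB: "x \<in> (\<Pi>\<^sub>E l\<in>{1..k}. cball 0 1)"
    proof (rule PiE_I)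
      fix l assume "l \<in> {1..k}"
      then show "x l \<in> cball 0 1" using xn[of l] by simp
    next
      fix l assume "l \<notin> {1..k}"
      then show "x l = undefined" using x unfolding B_def by (rule PiE_arb[rotated])
    qed
    have "Delta_pow 1 \<alpha> (0 # pts x 1 k) > 0"
    proof (cases "\<alpha> = 0")
      case True
      then show ?thesis using edges by (simp add: Delta_pow_def)
    next
      case False
      then have kd: "k \<le> CARD('d)" using k\<alpha> by (metis not_le)
      have "dist ((x \<circ> \<rho>) i) (p i) < \<epsilon>0" if "i \<in> K" for i
      proof -
        have "\<rho> i \<in> {1..k}" using index_set_image(1)[OF \<rho> kd] that unfolding K_def by blast
        from xq[OF this] show ?thesis using \<epsilon>(3) by (simp add: q\<rho>)
      qed
      then have "gram K (x \<circ> \<rho>) > 0" by (intro \<epsilon>0(2)) blast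
      then show ?thesis
        using edges measure_std_prism_pos[of K] unfolding Delta_pow_simplex[OF \<rho> kd False] K_def[symmetric] by simp
    qed
    then show ?thesis unfolding G_def using xB by simp
  qed
  have B: "B \<in> sets (Pi\<^sub>M {1..k} M)"
    unfolding B_def by (intro sets_PiM_I_finite) (auto simp: M_def)
  have "emeasure (Pi\<^sub>M {1..k} M) B = (\<Prod>l\<in>{1..k}. emeasure lborel (ball (q l) \<epsilon>))"
    unfolding B_def by (subst P.emeasure_PiM) (auto simp: M_def)
  also have "\<dots> \<noteq> 0"
  proof -
    have "emeasure lborel (ball (q l) \<epsilon>) \<noteq> 0" for l
      using content_ball_pos[OF \<epsilon>(1), of "q l"] by (auto simp: Sigma_Algebra.measure_def)
    then show ?thesis by simp
  qed
  finally have Bpos: "emeasure (Pi\<^sub>M {1..k} M) B \<noteq> 0" .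
  have "integral\<^sup>L (Pi\<^sub>M {1..k} M) G \<noteq> 0"
  proof
    assume "integral\<^sup>L (Pi\<^sub>M {1..k} M) G = 0"
    then have "AE x in Pi\<^sub>M {1..k} M. G x = 0"
      using integral_nonneg_eq_0_iff_AE[OF int] nonneg by simp
    then have "AE x in Pi\<^sub>M {1..k} M. x \<notin> B"
      by eventually_elim (use GB in force)
    then have "B \<in> null_sets (Pi\<^sub>M {1..k} M)"
      using AE_iff_null_sets[OF B] by simp
    then show False using Bpos by auto
  qed
  moreover have "integral\<^sup>L (Pi\<^sub>M {1..k} M) G \<ge> 0"
    using nonneg by (intro Bochner_Integration.integral_nonneg) simp
  ultimately show ?thesis unfolding mu by simp
qed

section \<open>Factorization of the mixed moments\<close>

text \<open>For m = 1 the second simplex uses the points k1 + 1 to k1 + k2, a block disjoint from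
  the first. Splitting the product measure there and shifting the second block down by k1 separates
  the variables; integrability of both factors justifies Fubini.\<close>

lemma mu2_one_eq_mu_mult:
  assumes 1: "\<alpha>1 > - real CARD('d) + real k1 - 1" "k1 > CARD('d) \<Longrightarrow> \<alpha>1 = 0"
    and 2: "\<alpha>2 > - real CARD('d) + real k2 - 1" "k2 > CARD('d) \<Longrightarrow> \<alpha>2 = 0"
  shows "mu2 TYPE('d::finite) k1 k2 1 \<alpha>1 \<alpha>2 = mu TYPE('d) k1 \<alpha>1 * mu TYPE('d) k2 \<alpha>2"
proof -
  define M where "M = (\<lambda>_::nat. lborel :: (real^'d) measure)"
  interpret P: product_sigma_finite M unfolding M_def ..
  define J where "J = {1 + k1..k2 + k1}"
  \<comment> \<open>The restricted lambda makes \<open>t y\<close> extensional on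
    \<open>{1..k2}\<close>, hence an element of the smaller product space.\<close>
  define t where "t = (\<lambda>y :: nat \<Rightarrow> real^'d. \<lambda>l\<in>{1..k2}. y (l + k1))"
  define G where "G k \<alpha> x = indicator (\<Pi>\<^sub>E l\<in>{1..k}. cball 0 1) x *\<^sub>R Delta_pow 1 \<alpha> (0 # pts x 1 k)"
    for k \<alpha> and x :: "nat \<Rightarrow> real^'d"
  have mu: "mu TYPE('d) k \<alpha> = integral\<^sup>L (Pi\<^sub>M {1..k} M) (G k \<alpha>)" for k \<alpha>
    unfolding mu_def set_lebesgue_integral_def M_def G_def ..
  have int1: "integrable (Pi\<^sub>M {1..k1} M) (G k1 \<alpha>1)"
    unfolding M_def G_def using 1 by (rule Delta_pow_integrable)
  have int2: "integrable (Pi\<^sub>M {1..k2} M) (G k2 \<alpha>2)"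
    unfolding M_def G_def using 2 by (rule Delta_pow_integrable)
  have t_meas: "t \<in> measurable (Pi\<^sub>M I M) (Pi\<^sub>M {1..k2} M)" if "J \<subseteq> I" for I
    unfolding t_def
  proof (rule measurable_restrict)
    fix l assume "l \<in> {1..k2}"
    then have "l + k1 \<in> I" using that by (auto simp: J_def)
    from measurable_component_singleton[OF this, of M]
    show "(\<lambda>y. y (l + k1)) \<in> measurable (Pi\<^sub>M I M) (M l)" by (simp add: M_def)
  qed
  \<comment> \<open>Both measures are determined by their values on boxes, and the shift merely
    renumbers the sides of a box.\<close>
  have t_distr: "distr (Pi\<^sub>M J M) (Pi\<^sub>M {1..k2} M) t = Pi\<^sub>M {1..k2} M"
  proof (rule P.PiM_eqI)
    fix A assume A: "\<And>l. l \<in> {1..k2} \<Longrightarrow> A l \<in> sets (M l)"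
    have Jim: "J = (\<lambda>l. l + k1) ` {1..k2}" by (simp add: J_def)
    have J_iff: "(\<forall>n\<in>J. x n \<in> A (n - k1)) \<longleftrightarrow> (\<forall>l\<in>{1..k2}. x (l + k1) \<in> A l)" for x
      by (simp add: Jim del: image_add_atLeastAtMost')
    have AJ: "A (n - k1) \<in> sets (M n)" if "n \<in> J" for n
    proof -
      have "n - k1 \<in> {1..k2}" using that unfolding J_def atLeastAtMost_iff by linarith
      from A[OF this] show ?thesis by (simp add: M_def)
    qed
    have "t y \<in> Pi\<^sub>E {1..k2} A \<longleftrightarrow> (\<forall>l\<in>{1..k2}. y (l + k1) \<in> A l)" for y
      unfolding t_def by (simp add: PiE_iff)
    then have "t -` Pi\<^sub>E {1..k2} A \<inter> space (Pi\<^sub>M J M) = (\<Pi>\<^sub>E n\<in>J. A (n - k1))"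
      unfolding J_iff[symmetric] by (auto simp: space_PiM PiE_iff M_def)
    then have "emeasure (distr (Pi\<^sub>M J M) (Pi\<^sub>M {1..k2} M) t) (Pi\<^sub>E {1..k2} A)
        = emeasure (Pi\<^sub>M J M) (\<Pi>\<^sub>E n\<in>J. A (n - k1))"
      using t_meas[of J] A by (subst emeasure_distr) (auto intro!: sets_PiM_I_finite)
    also have "\<dots> = (\<Prod>n\<in>J. emeasure (M n) (A (n - k1)))"
      using AJ by (intro P.emeasure_PiM) (auto simp: J_def)
    also have "\<dots> = (\<Prod>l\<in>{1..k2}. emeasure (M l) (A l))"
      unfolding J_def prod.shift_bounds_cl_nat_ivl by (simp add: M_def)
    finally show "emeasure (distr (Pi\<^sub>M J M) (Pi\<^sub>M {1..k2} M) t) (Pi\<^sub>E {1..k2} A) = (\<Prod>l\<in>{1..k2}. emeasure (M l) (A l))" .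
  qed auto
  have intt: "integrable (Pi\<^sub>M J M) (\<lambda>y. G k2 \<alpha>2 (t y))"
    and int_eq: "integral\<^sup>L (Pi\<^sub>M J M) (\<lambda>y. G k2 \<alpha>2 (t y)) = mu TYPE('d) k2 \<alpha>2"
  proof -
    have "integrable (distr (Pi\<^sub>M J M) (Pi\<^sub>M {1..k2} M) t) (G k2 \<alpha>2)"
      unfolding t_distr by (rule int2)
    then show "integrable (Pi\<^sub>M J M) (\<lambda>y. G k2 \<alpha>2 (t y))"
      by (rule integrable_distr[OF t_meas[OF subset_refl]])
    have "integral\<^sup>L (distr (Pi\<^sub>M J M) (Pi\<^sub>M {1..k2} M) t) (G k2 \<alpha>2) = integral\<^sup>L (Pi\<^sub>M J M) (\<lambda>y. G k2 \<alpha>2 (t y))"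
      using t_meas[OF subset_refl] borel_measurable_integrable[OF int2] by (rule integral_distr)
    then show "integral\<^sup>L (Pi\<^sub>M J M) (\<lambda>y. G k2 \<alpha>2 (t y)) = mu TYPE('d) k2 \<alpha>2"
      unfolding t_distr mu by simp
  qed
  \<comment> \<open>Restricting to the first block and shifting the second lets the indicator of the
    large product of balls split into the two indicators inside \<open>G\<close>.\<close>
  define f where "f x = G k1 \<alpha>1 (restrict x {1..k1}) * G k2 \<alpha>2 (t x)" for x
  have IJ: "{1..k1} \<inter> J = {}" "{1..k1} \<union> J = {1..k1 + k2}"
    by (auto simp: J_def)
  have f_meas: "f \<in> borel_measurable (Pi\<^sub>M {1..k1 + k2} M)"
  proof -
    have "(\<lambda>x. restrict x {1..k1}) \<in> measurable (Pi\<^sub>M {1..k1 + k2} M) (Pi\<^sub>M {1..k1} M)"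
      by (rule measurable_restrict_subset) auto
    from measurable_compose[OF this borel_measurable_integrable[OF int1]]
      measurable_compose[OF t_meas[of "{1..k1 + k2}"] borel_measurable_integrable[OF int2]]
    show ?thesis
      unfolding f_def[abs_def] using IJ by (intro borel_measurable_times) auto
  qed
  have "mu2 TYPE('d) k1 k2 1 \<alpha>1 \<alpha>2 = integral\<^sup>L (Pi\<^sub>M {1..k1 + k2} M) f"
    unfolding mu2_def set_lebesgue_integral_def M_def[symmetric] add_diff_cancel_right'
  proof (rule Bochner_Integration.integral_cong[OF refl])
    fix x assume "x \<in> space (Pi\<^sub>M {1..k1 + k2} M)"
    then have ext: "x \<in> extensional {1..k1 + k2}" by (simp add: space_PiM PiE_iff)
    have "x \<in> (\<Pi>\<^sub>E l\<in>{1..k1 + k2}. cball 0 1) \<longleftrightarrow> (\<forall>l\<in>{1..k1} \<union> J. x l \<in> cball 0 1)"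
      unfolding IJ using ext by (simp add: PiE_iff)
    also have "\<dots> \<longleftrightarrow> restrict x {1..k1} \<in> (\<Pi>\<^sub>E l\<in>{1..k1}. cball 0 1) \<and> t x \<in> (\<Pi>\<^sub>E l\<in>{1..k2}. cball 0 1)"
    proof -
      have "J = (\<lambda>l. l + k1) ` {1..k2}" by (simp add: J_def)
      then have "(\<forall>l\<in>J. x l \<in> cball 0 1) \<longleftrightarrow> t x \<in> (\<Pi>\<^sub>E l\<in>{1..k2}. cball 0 1)"
        by (simp add: t_def PiE_iff del: image_add_atLeastAtMost')
      then show ?thesis by (simp add: ball_Un PiE_iff)
    qed
    finally have iff: "x \<in> (\<Pi>\<^sub>E l\<in>{1..k1 + k2}. cball 0 1) \<longleftrightarrow>
      restrict x {1..k1} \<in> (\<Pi>\<^sub>E l\<in>{1..k1}. cball 0 1) \<and> t x \<in> (\<Pi>\<^sub>E l\<in>{1..k2}. cball 0 1)" .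
    have p1: "pts (restrict x {1..k1}) 1 k1 = pts x 1 k1"
      unfolding pts_def by (rule map_cong[OF refl]) (simp del: upt_Suc)
    \<comment> \<open>The bounds are those of \<open>mu2\<close> at m = 1; the subtraction k1 + 2 -
      1 is exact and gives k1 + 1, the first index of the second block.\<close>
    have p2: "pts (t x) 1 k2 = pts x (k1 + 2 - 1) (k1 + k2 + 1 - 1)"
      by (rule nth_equalityI) (auto simp: pts_def t_def nth_append simp del: upt_Suc intro!: arg_cong[where f = x])
    show "indicat_real (\<Pi>\<^sub>E l\<in>{1..k1 + k2}. cball 0 1) x *\<^sub>R
        (Delta_pow 1 \<alpha>1 (0 # pts x 1 k1) * Delta_pow 1 \<alpha>2 (0 # pts x (k1 + 2 - 1) (k1 + k2))) = f x"
      unfolding f_def G_def p1 p2 using iff by (simp add: indicator_def)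
  qed
  also have "\<dots> = integral\<^sup>L (Pi\<^sub>M {1..k1} M \<Otimes>\<^sub>M Pi\<^sub>M J M) (\<lambda>w. f (merge {1..k1} J w))"
  proof -
    have d: "distr (Pi\<^sub>M {1..k1} M \<Otimes>\<^sub>M Pi\<^sub>M J M) (Pi\<^sub>M {1..k1 + k2} M) (merge {1..k1} J) = Pi\<^sub>M {1..k1 + k2} M"
      using P.distr_merge[OF IJ(1)] unfolding IJ by (simp add: J_def)
    have "merge {1..k1} J \<in> measurable (Pi\<^sub>M {1..k1} M \<Otimes>\<^sub>M Pi\<^sub>M J M) (Pi\<^sub>M {1..k1 + k2} M)"
      using measurable_merge[of "{1..k1}" J M] unfolding IJ .
    from integral_distr[OF this f_meas] show ?thesis unfolding d .
  qed
  also have "\<dots> = integral\<^sup>L (Pi\<^sub>M {1..k1} M \<Otimes>\<^sub>M Pi\<^sub>M J M) (\<lambda>w. G k1 \<alpha>1 (fst w) * G k2 \<alpha>2 (t (snd w)))"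
  proof (rule Bochner_Integration.integral_cong[OF refl])
    fix w assume "w \<in> space (Pi\<^sub>M {1..k1} M \<Otimes>\<^sub>M Pi\<^sub>M J M)"
    then obtain x y where w: "w = (x, y)" "x \<in> space (Pi\<^sub>M {1..k1} M)" "y \<in> space (Pi\<^sub>M J M)"
      by (auto simp: space_pair_measure)
    have "x \<in> extensional {1..k1}" using w(2) by (simp add: space_PiM PiE_iff)
    then have "restrict (merge {1..k1} J (x, y)) {1..k1} = x"
      by (auto simp: merge_def restrict_def extensional_def)
    moreover have "t (merge {1..k1} J (x, y)) = t y"
      by (auto simp: t_def merge_def J_def restrict_def)
    ultimately show "f (merge {1..k1} J w) = G k1 \<alpha>1 (fst w) * G k2 \<alpha>2 (t (snd w))"
      by (simp add: f_def w(1))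
  qed
  also have "\<dots> = (LINT x|Pi\<^sub>M {1..k1} M. LINT y|Pi\<^sub>M J M. G k1 \<alpha>1 x * G k2 \<alpha>2 (t y))"
  proof -
    interpret pair_sigma_finite "Pi\<^sub>M {1..k1} M" "Pi\<^sub>M J M"
      by (intro pair_sigma_finite.intro P.sigma_finite) (auto simp: J_def)
    have "integrable (Pi\<^sub>M {1..k1} M \<Otimes>\<^sub>M Pi\<^sub>M J M) (\<lambda>w. G k1 \<alpha>1 (fst w) * G k2 \<alpha>2 (t (snd w)))"
    proof (rule Fubini_integrable)
      show "(\<lambda>w. G k1 \<alpha>1 (fst w) * G k2 \<alpha>2 (t (snd w))) \<in> borel_measurable (Pi\<^sub>M {1..k1} M \<Otimes>\<^sub>M Pi\<^sub>M J M)"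
        using borel_measurable_integrable[OF int1] borel_measurable_integrable[OF intt]
        by (intro borel_measurable_times measurable_compose[OF measurable_fst] measurable_compose[OF measurable_snd])
      show "integrable (Pi\<^sub>M {1..k1} M) (\<lambda>x. LINT y|Pi\<^sub>M J M. norm (G k1 \<alpha>1 (fst (x, y)) * G k2 \<alpha>2 (t (snd (x, y)))))"
        using int1 by (simp add: abs_mult)
      show "AE x in Pi\<^sub>M {1..k1} M. integrable (Pi\<^sub>M J M) (\<lambda>y. G k1 \<alpha>1 (fst (x, y)) * G k2 \<alpha>2 (t (snd (x, y))))"
        using intt by simp
    qed
    from integral_fst'[OF this] show ?thesis by simp
  qed
  also have "\<dots> = mu TYPE('d) k1 \<alpha>1 * mu TYPE('d) k2 \<alpha>2"
    unfolding mu[of k1] by (simp add: int_eq)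
  finally show ?thesis .
qed

theorem corollary5p3:
  fixes n :: nat and k :: "nat \<Rightarrow> nat" and \<alpha> a :: "nat \<Rightarrow> real" and b l1 l2 :: real
    and v :: "nat \<Rightarrow> nat \<Rightarrow> real" and \<Sigma> D S T :: "real Matrix.mat"
  assumes "n \<ge> 2"
    and "admissible TYPE('d::finite) n k \<alpha>"
    and "\<Sigma> = cov_supercritical TYPE('d) n k \<alpha>"
    and "\<And>i. i \<in> {1..n} \<Longrightarrow> a i = fact (k i) / mu TYPE('d) (k i) (\<alpha> i)"
    and "b = (\<Sum>j\<in>{1..n}. \<Prod>l\<in>{1..n} - {j}. (a l)\<^sup>2)"
    and "l1 = 0"
    and "l2 = (\<Sum>i\<in>{1..n}. 1 / (a i)\<^sup>2)"
    and "D = mat1 n (\<lambda>i j. if i = j then (if i = n then l2 else l1) else 0)"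
    and "\<And>i j. i \<in> {1..n-1} \<Longrightarrow> j \<in> {1..n} \<Longrightarrow>
           v i j = (if j = 1 then a 1 / a (i + 1) else if j = i + 1 then -1 else 0)"
    and "\<And>j. j \<in> {1..n} \<Longrightarrow> v n j = (if j = n then 1 else a n / a j)"
    and "S = mat1 n (\<lambda>i j. v j i)"
    and "T = mat1 n (\<lambda>i j.
           if i = n then (\<Prod>l\<in>{1..n}. (a l)\<^sup>2) / (a j * a n * b)
           else if j = i + 1 then
             - (\<Sum>m\<in>{1..n} - {i + 1}. (a (i + 1))\<^sup>2 * (\<Prod>l\<in>{1..n} - {m, i + 1}. (a l)\<^sup>2)) / b
           else (\<Prod>l\<in>{1..n}. (a l)\<^sup>2) / (a (i + 1) * a j * b))"
  shows "similar_mat \<Sigma> D \<and> inverts_mat S T \<and> inverts_mat T S \<and> D = T * \<Sigma> * S"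
proof (rule rank_one_similar[OF assms(1) _ _ assms(5-12)])
  have adm: "\<alpha> i > - real CARD('d) + real (k i) - 1" "k i > CARD('d) \<Longrightarrow> \<alpha> i = 0" if "i \<in> {1..n}" for i
    using assms(2) that unfolding admissible_def by auto
  show "\<Sigma> = mat1 n (\<lambda>i j. 1 / (a i * a j))"
    unfolding assms(3) cov_supercritical_def
  proof (rule mat1_cong)
    fix i j assume "i \<in> {1..n}" "j \<in> {1..n}"
    then show "mu2 TYPE('d) (k i) (k j) 1 (\<alpha> i) (\<alpha> j) / (fact (k i) * fact (k j)) = 1 / (a i * a j)"
      using mu2_one_eq_mu_mult[OF adm(1,2) adm(1,2), of i j] by (simp add: assms(4))
  qed
  \<comment> \<open>A vanishing moment would make \<open>a i\<close> a division by zero, that is 0,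
    so strict positivity is what is required here.\<close>
  show "a i \<noteq> 0" if "i \<in> {1..n}" for i
    using mu_pos[OF adm[OF that]] by (simp add: assms(4)[OF that])
qed

end
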